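(* Let $\varepsilon>0$, let condition (N) hold for $(b_{ij})$, and let $(\boldsymbol\rho^\varepsilon,v^\varepsilon)$ with $v^\varepsilon=0$ and $\rho_i^\varepsilon>0$ be a (sufficiently smooth and decaying) solution on $\mathbb R^3$ of $$\partial_t\rho_i^\varepsilon+\operatorname{div}(\rho_i^\varepsilon v^\varepsilon)=-\operatorname{div}(\rho_i^\varepsilon u_i^\varepsilon)\ (i=1,\dots,n),\qquad\partial_t(\rho^\varepsilon v^\varepsilon)+\operatorname{div}(\rho^\varepsilon v^\varepsilon\otimes v^\varepsilon)=-\sum_{i=1}^n\rho_i^\varepsilon\nabla\frac{\delta\mathcal E}{\delta\rho_i}(\boldsymbol\rho^\varepsilon),\qquad\rho^\varepsilon=\sum_{i=1}^n\rho_i^\varepsilon,$$ where $(u_1^\varepsilon,\dots,u_n^\varepsilon)$ is the solution of $$-\sum_{j=1}^nb_{ij}\rho_i^\varepsilon\rho_j^\varepsilon(u_i^\varepsilon-u_j^\varepsilon)=\varepsilon d_i^\varepsilon,\qquad\sum_{j=1}^n\rho_j^\varepsilon u_j^\varepsilon=0,\qquad d_i^\varepsilon=-\frac{\rho_i^\varepsilon}{\rho^\varepsilon}\sum_{j=1}^n\rho_j^\varepsilon\nabla\frac{\delta\mathcal E}{\delta\rho_j}(\boldsymbol\rho^\varepsilon)+\rho_i^\varepsilon\nabla\frac{\delta\mathcal E}{\delta\rho_i}(\boldsymbol\rho^\varepsilon).$$ Suppose that $\mathcal E(\boldsymbol\rho^\varepsilon)$ is strictly convex (in the sense given in the context). Then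 $\boldsymbol\rho^\varepsilon$ solves $$\partial_t\rho_i^\varepsilon=\varepsilon\operatorname{div}\sum_{j=1}^{n-1}\widetilde D_{ij}^\varepsilon\nabla\frac{\delta\widetilde{\mathcal E}}{\delta\rho_j}(\widetilde{\boldsymbol\rho}^\varepsilon),\qquad i=1,\dots,n-1,\qquad( * )$$ the matrix $\widetilde D^\varepsilon=(\widetilde D_{ij}^\varepsilon)\in\mathbb R^{(n-1)\times(n-1)}$ is positive definite, and the energy $\widetilde{\mathcal E}$ is a Lyapunov functional along solutions of $( * )$: $$\frac{d\widetilde{\mathcal E}}{dt}=-\varepsilon\int_{\mathbb R^3}\sum_{i,j=1}^{n-1}\widetilde D_{ij}^\varepsilon\nabla\frac{\delta\widetilde{\mathcal E}}{\delta\rho_i}\cdot\nabla\frac{\delta\widetilde{\mathcal E}}{\delta\rho_j}\,dx\le0.$$ Moreover, since $\rho_i^\varepsilon>0$ for $i=1,\dots,n$, all eigenvalues of $\widetilde D^\varepsilon\widetilde{\mathcal E}''$ are real and positive, where $\widetilde{\mathcal E}''=d^2\widetilde{\mathcal E}/d\widetilde{\boldsymbol\rho}^2$ is the Hessian of $\widetilde{\mathcal E}$; that is, $( * )$ is parabolic in the sense of Petrovskii.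
   Context: $\boldsymbol\rho=(\rho_1,\dots,\rho_n)$; $\mathcal E(\boldsymbol\rho)=\int_{\mathbb R^3}\sum_{i=1}^nF_i(\rho_i,\nabla\rho_i)dx$, $\frac{\delta\mathcal E}{\delta\rho_i}(\boldsymbol\rho)=\frac{\partial F_i}{\partial\rho_i}(\rho_i,\nabla\rho_i)-\operatorname{div}\frac{\partial F_i}{\partial q_i}(\rho_i,\nabla\rho_i)$ ($F_i=F_i(\rho_i,q_i)$). Condition (N): $(b_{ij})\in\mathbb R^{n\times n}$ is symmetric with $b_{ij}\ge0$, and for any $\rho_1,\dots,\rho_n>0$ the linear system $\sum_{j=1}^nb_{ij}\rho_i\rho_j(v_i-v_j)=0$, $i=1,\dots,n$, has the one-dimensional null space $\operatorname{span}\{(1,\dots,1)\}$. Reduced variables: when $v^\varepsilon=0$, summing the mass equations gives $\partial_t\rho^\varepsilon=0$, so $\rho^\varepsilon=\sum_i\rho_i^\varepsilon$ is a given function independent of time; set $\widetilde{\boldsymbol\rho}^\varepsilon=(\rho_1^\varepsilon,\dots,\rho_{n-1}^\varepsilon)$ and $\widetilde{\mathcal E}(\widetilde{\boldsymbol\rho}^\varepsilon)=\mathcal E\big(\rho_1^\varepsilon,\dots,\rho_{n-1}^\varepsilon,\rho^\varepsilon-\sum_{i=1}^{n-1}\rho_i^\varepsilon\big)$. Matrix $\widetilde D^\varepsilon=(Q^\varepsilon)^{-1}(\tau^\varepsilon)^{-1}(Q^\varepsilon)^{-1}$, where $(Q^\varepsilon)^{-1}_{ij}=\delta_{ij}\rho_i^\varepsilon-\rho_i^\varepsilon\rho_j^\varepsilon/\rho^\varepsilon$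 for $i,j=1,\dots,n-1$, and $\tau^\varepsilon=(\tau^\varepsilon_{ij})_{i,j=1,\dots,n-1}$ is the (after reordering of indices if necessary) invertible submatrix of the rank-$(n-1)$ matrix $\tau_{ij}^\varepsilon=\delta_{ij}\sum_{k=1}^nb_{ik}\rho_i^\varepsilon\rho_k^\varepsilon-b_{ij}\rho_i^\varepsilon\rho_j^\varepsilon$, $i,j=1,\dots,n$. Hessians are understood as (pointwise) matrices of second derivatives of the energy density with respect to the density variables: $\widetilde{\mathcal E}''\in\mathbb R^{(n-1)\times(n-1)}$ with respect to $(\rho_1,\dots,\rho_{n-1})$ (with $\rho^\varepsilon$ fixed), and "strictly convex" means that the Hessian of the energy with respect to $(\rho_1,\dots,\rho_n)$ is positive definite. A second-order system is called parabolic in the sense of Petrovskii if the real parts of the eigenvalues of the diffusion matrix are positive. *)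

theory Defs
  imports "HOL-Analysis.Analysis"
begin

definition grad :: "(real^3 \<Rightarrow> real) \<Rightarrow> real^3 \<Rightarrow> real^3" where
  "grad f x = (\<chi> k. frechet_derivative f (at x) (axis k 1))"

definition divergence :: "(real^3 \<Rightarrow> real^3) \<Rightarrow> real^3 \<Rightarrow> real" where
  "divergence w x = (\<Sum>k\<in>UNIV. frechet_derivative (\<lambda>y. w y $ k) (at x) (axis k 1))"

definition tensor :: "real^3 \<Rightarrow> real^3 \<Rightarrow> real^3^3" where
  "tensor v w = (\<chi> k l. v $ k * w $ l)"

definition tensor_divergence :: "(real^3 \<Rightarrow> real^3^3) \<Rightarrow> real^3 \<Rightarrow> real^3" where
  "tensor_divergence T x = (\<chi> k. divergence (\<lambda>y. T y $ k) x)"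

definition grads :: "(real^3 \<Rightarrow> real^'k) \<Rightarrow> real^3 \<Rightarrow> real^3^('k::finite)" where
  "grads r x = (\<chi> i. grad (\<lambda>y. r y $ i) x)"

definition hessian :: "(real^'k \<Rightarrow> real) \<Rightarrow> real^'k \<Rightarrow> real^'k^('k::finite)" where
  "hessian f r = (\<chi> i j. frechet_derivative
     (\<lambda>r'. frechet_derivative f (at r') (axis j 1)) (at r) (axis i 1))"

text \<open>k times continuously differentiable; meant for open sets \<open>S\<close>.\<close>

primrec Ck_on :: "nat \<Rightarrow> 'a::euclidean_space set \<Rightarrow> ('a \<Rightarrow> 'b::real_normed_vector) \<Rightarrow> bool" where
  "Ck_on 0 S f \<longleftrightarrow> continuous_on S f"
| "Ck_on (Suc k) S f \<longleftrightarrow> (\<forall>x\<in>S. f differentiable (at x)) \<and>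
     (\<forall>h. Ck_on k S (\<lambda>x. frechet_derivative f (at x) h))"

text \<open>The Sobolev class $W^{1,1}$, used for differentiable vector fields only. It makes the
  integral of the divergence vanish.\<close>

definition W11 :: "(real^3 \<Rightarrow> real^3) \<Rightarrow> bool" where
  "W11 w \<longleftrightarrow> integrable lborel w \<and>
     (\<forall>k l. integrable lborel (\<lambda>x. frechet_derivative (\<lambda>y. w y $ k) (at x) (axis l 1)))"

definition pos_def :: "real^'k^('k::finite) \<Rightarrow> bool" where
  "pos_def A \<longleftrightarrow> transpose A = A \<and> (\<forall>z. z \<noteq> 0 \<longrightarrow> 0 < z \<bullet> (A *v z))"

definition complex_eigenvalue :: "real^'k^('k::finite) \<Rightarrow> complex \<Rightarrow> bool" where
  "complex_eigenvalue A \<mu> \<longleftrightarrow>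
     (\<exists>v. v \<noteq> 0 \<and> map_matrix complex_of_real A *v v = \<mu> *s v)"

definition petrovskii_parabolic :: "real^'k^('k::finite) \<Rightarrow> bool" where
  "petrovskii_parabolic A \<longleftrightarrow> (\<forall>\<mu>. complex_eigenvalue A \<mu> \<longrightarrow> 0 < Re \<mu>)"

text \<open>
  The \<open>n\<close> species are indexed by \<open>'m option\<close>: the indices \<open>Some j\<close> are the species \<open>1, ..., n - 1\<close>
  kept in the reduced description and \<open>None\<close> is the eliminated species \<open>n\<close>; thus
  \<open>n = CARD('m) + 1\<close>.
\<close>

definition total_density :: "(real^3 \<Rightarrow> real^('k::finite)) \<Rightarrow> real^3 \<Rightarrow> real" where
  "total_density r x = (\<Sum>i\<in>UNIV. r x $ i)"

definition reduced_profile :: "(real^3 \<Rightarrow> real^('m::finite option)) \<Rightarrow> real^3 \<Rightarrow> real^'m" where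
  "reduced_profile r x = (\<chi> j. r x $ Some j)"

text \<open>\<open>(s\<^sub>1, ..., s\<^sub>n\<^sub>-\<^sub>1)\<close> is completed by \<open>c - (s\<^sub>1 + ... + s\<^sub>n\<^sub>-\<^sub>1)\<close>; used for densities and
  for their gradients.\<close>

definition completion :: "'a::ab_group_add \<Rightarrow> 'a^('m::finite) \<Rightarrow> 'a^('m option)" where
  "completion c s = (\<chi> i. case i of None \<Rightarrow> c - (\<Sum>j\<in>UNIV. s $ j) | Some j \<Rightarrow> s $ j)"

definition completed_profile ::
  "(real^3 \<Rightarrow> real) \<Rightarrow> (real^3 \<Rightarrow> real^('m::finite)) \<Rightarrow> real^3 \<Rightarrow> real^('m option)" where
  "completed_profile R s x = completion (R x) (s x)"

definition energy_density ::
  "('k::finite \<Rightarrow> real \<Rightarrow> real^3 \<Rightarrow> real) \<Rightarrow> real^'k \<Rightarrow> real^3^'k \<Rightarrow> real" where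
  "energy_density F r q = (\<Sum>i\<in>UNIV. F i (r $ i) (q $ i))"

definition energy ::
  "('k::finite \<Rightarrow> real \<Rightarrow> real^3 \<Rightarrow> real) \<Rightarrow> (real^3 \<Rightarrow> real^'k) \<Rightarrow> real" where
  "energy F r = (LINT x|lborel. energy_density F (r x) (grads r x))"

definition red_energy ::
  "('m::finite option \<Rightarrow> real \<Rightarrow> real^3 \<Rightarrow> real) \<Rightarrow> (real^3 \<Rightarrow> real)
     \<Rightarrow> (real^3 \<Rightarrow> real^'m) \<Rightarrow> real" where
  "red_energy F R s = energy F (completed_profile R s)"

text \<open>Density of the reduced energy as a function of the point, of the \<open>n - 1\<close> densities and of
  their gradients. It depends on the point through the given total density \<open>R\<close>.\<close>

definition red_density ::
  "('m::finite option \<Rightarrow> real \<Rightarrow> real^3 \<Rightarrow> real) \<Rightarrow> (real^3 \<Rightarrow> real)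
     \<Rightarrow> real^3 \<Rightarrow> real^'m \<Rightarrow> real^3^'m \<Rightarrow> real" where
  "red_density F R x r q = energy_density F (completion (R x) r) (completion (grad R x) q)"

definition dF_dq ::
  "('k::finite \<Rightarrow> real \<Rightarrow> real^3 \<Rightarrow> real) \<Rightarrow> (real^3 \<Rightarrow> real^'k) \<Rightarrow> 'k \<Rightarrow> real^3 \<Rightarrow> real^3" where
  "dF_dq F r i x = grad (\<lambda>q. F i (r x $ i) q) (grads r x $ i)"

definition var_deriv ::
  "('k::finite \<Rightarrow> real \<Rightarrow> real^3 \<Rightarrow> real) \<Rightarrow> (real^3 \<Rightarrow> real^'k) \<Rightarrow> 'k \<Rightarrow> real^3 \<Rightarrow> real" where
  "var_deriv F r i x =
     deriv (\<lambda>a. F i a (grads r x $ i)) (r x $ i) - divergence (dF_dq F r i) x"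

text \<open>Variational derivative, i.e. Euler-Lagrange expression, of a functional
  $s \mapsto \int L(x, s(x), \nabla s(x))\,dx$ with respect to the \<open>j\<close>-th component.\<close>

definition euler_lagrange ::
  "(real^3 \<Rightarrow> real^'m \<Rightarrow> real^3^'m \<Rightarrow> real) \<Rightarrow> (real^3 \<Rightarrow> real^('m::finite))
     \<Rightarrow> 'm \<Rightarrow> real^3 \<Rightarrow> real" where
  "euler_lagrange L s j x =
     frechet_derivative (\<lambda>r. L x r (grads s x)) (at (s x)) (axis j 1) -
     divergence (\<lambda>y. \<chi> k. frechet_derivative (L y (s y)) (at (grads s y)) (axis j (axis k 1))) x"

definition red_var_deriv ::
  "('m::finite option \<Rightarrow> real \<Rightarrow> real^3 \<Rightarrow> real) \<Rightarrow> (real^3 \<Rightarrow> real)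
     \<Rightarrow> (real^3 \<Rightarrow> real^'m) \<Rightarrow> 'm \<Rightarrow> real^3 \<Rightarrow> real" where
  "red_var_deriv F R s = euler_lagrange (red_density F R) s"

definition energy_hessian ::
  "('k::finite \<Rightarrow> real \<Rightarrow> real^3 \<Rightarrow> real) \<Rightarrow> (real^3 \<Rightarrow> real^'k) \<Rightarrow> real^3 \<Rightarrow> real^'k^'k" where
  "energy_hessian F r x = hessian (\<lambda>a. energy_density F a (grads r x)) (r x)"

definition red_energy_hessian ::
  "('m::finite option \<Rightarrow> real \<Rightarrow> real^3 \<Rightarrow> real) \<Rightarrow> (real^3 \<Rightarrow> real)
     \<Rightarrow> (real^3 \<Rightarrow> real^'m) \<Rightarrow> real^3 \<Rightarrow> real^'m^'m" where
  "red_energy_hessian F R s x = hessian (\<lambda>a. red_density F R x a (grads s x)) (s x)"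

definition condition_N :: "real^'k^('k::finite) \<Rightarrow> bool" where
  "condition_N b \<longleftrightarrow> transpose b = b \<and> (\<forall>i j. 0 \<le> b $ i $ j) \<and>
     (\<forall>r::real^'k. (\<forall>i. 0 < r $ i) \<longrightarrow>
        {v::real^'k. \<forall>i. (\<Sum>j\<in>UNIV. b $ i $ j * r $ i * r $ j * (v $ i - v $ j)) = 0}
        = span {\<chi> i. 1})"

definition tau_full :: "real^'k^'k \<Rightarrow> real^'k \<Rightarrow> real^'k^('k::finite)" where
  "tau_full b r = (\<chi> i j.
     (if i = j then \<Sum>k\<in>UNIV. b $ i $ k * r $ i * r $ k else 0) - b $ i $ j * r $ i * r $ j)"

definition tau ::
  "real^('m option)^('m option) \<Rightarrow> real^('m option) \<Rightarrow> real^'m^('m::finite)" where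
  "tau b r = (\<chi> i j. tau_full b r $ Some i $ Some j)"

definition Qinv :: "real^('m::finite option) \<Rightarrow> real^'m^'m" where
  "Qinv r = (\<chi> i j. (if i = j then r $ Some i else 0)
     - r $ Some i * r $ Some j / (\<Sum>k\<in>UNIV. r $ k))"

definition Dmat ::
  "real^('m option)^('m option) \<Rightarrow> real^('m option) \<Rightarrow> real^'m^('m::finite)" where
  "Dmat b r = Qinv r ** matrix_inv (tau b r) ** Qinv r"

definition driving_force ::
  "('k::finite \<Rightarrow> real \<Rightarrow> real^3 \<Rightarrow> real) \<Rightarrow> (real^3 \<Rightarrow> real^'k) \<Rightarrow> 'k \<Rightarrow> real^3 \<Rightarrow> real^3" where
  "driving_force F r i x =
     - (r x $ i / total_density r x) *\<^sub>R (\<Sum>j\<in>UNIV. r x $ j *\<^sub>R grad (var_deriv F r j) x)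
     + r x $ i *\<^sub>R grad (var_deriv F r i) x"

definition maxwell_stefan ::
  "real \<Rightarrow> real^'k^'k \<Rightarrow> ('k::finite \<Rightarrow> real \<Rightarrow> real^3 \<Rightarrow> real) \<Rightarrow> (real^3 \<Rightarrow> real^'k)
     \<Rightarrow> (real^3 \<Rightarrow> real^3^'k) \<Rightarrow> bool" where
  "maxwell_stefan \<epsilon> b F r u \<longleftrightarrow> (\<forall>x.
     (\<forall>i. - (\<Sum>j\<in>UNIV. (b $ i $ j * r x $ i * r x $ j) *\<^sub>R (u x $ i - u x $ j))
            = \<epsilon> *\<^sub>R driving_force F r i x) \<and>
     (\<Sum>j\<in>UNIV. r x $ j *\<^sub>R u x $ j) = 0)"

definition mass_equations ::
  "real set \<Rightarrow> (real \<Rightarrow> real^3 \<Rightarrow> real^'k) \<Rightarrow> (real \<Rightarrow> real^3 \<Rightarrow> real^3)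
     \<Rightarrow> (real \<Rightarrow> real^3 \<Rightarrow> real^3^('k::finite)) \<Rightarrow> bool" where
  "mass_equations I \<rho> v u \<longleftrightarrow> (\<forall>t\<in>I. \<forall>x i.
     ((\<lambda>s. \<rho> s x $ i) has_real_derivative
        (- divergence (\<lambda>y. \<rho> t y $ i *\<^sub>R u t y $ i) x - divergence (\<lambda>y. \<rho> t y $ i *\<^sub>R v t y) x)) (at t))"

definition momentum_equation ::
  "real set \<Rightarrow> ('k::finite \<Rightarrow> real \<Rightarrow> real^3 \<Rightarrow> real) \<Rightarrow> (real \<Rightarrow> real^3 \<Rightarrow> real^'k)
     \<Rightarrow> (real \<Rightarrow> real^3 \<Rightarrow> real^3) \<Rightarrow> bool" where
  "momentum_equation I F \<rho> v \<longleftrightarrow> (\<forall>t\<in>I. \<forall>x.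
     ((\<lambda>s. total_density (\<rho> s) x *\<^sub>R v s x) has_vector_derivative
        (- (\<Sum>i\<in>UNIV. \<rho> t x $ i *\<^sub>R grad (var_deriv F (\<rho> t) i) x)
         - tensor_divergence (\<lambda>y. total_density (\<rho> t) y *\<^sub>R tensor (v t y) (v t y)) x)) (at t))"

definition red_flux ::
  "real^('m option)^('m option) \<Rightarrow> ('m::finite option \<Rightarrow> real \<Rightarrow> real^3 \<Rightarrow> real)
     \<Rightarrow> (real^3 \<Rightarrow> real) \<Rightarrow> (real^3 \<Rightarrow> real^'m) \<Rightarrow> 'm \<Rightarrow> real^3 \<Rightarrow> real^3" where
  "red_flux b F R s i x =
     (\<Sum>j\<in>UNIV. Dmat b (completed_profile R s x) $ i $ j *\<^sub>R grad (red_var_deriv F R s j) x)"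

definition reduced_system ::
  "real \<Rightarrow> real^('m option)^('m option) \<Rightarrow> ('m::finite option \<Rightarrow> real \<Rightarrow> real^3 \<Rightarrow> real)
     \<Rightarrow> (real^3 \<Rightarrow> real) \<Rightarrow> real set \<Rightarrow> (real \<Rightarrow> real^3 \<Rightarrow> real^'m) \<Rightarrow> bool" where
  "reduced_system \<epsilon> b F R I s \<longleftrightarrow> (\<forall>t\<in>I. \<forall>x i.
     ((\<lambda>a. s a x $ i) has_real_derivative \<epsilon> * divergence (red_flux b F R (s t) i) x) (at t))"

definition dissipation ::
  "real^('m option)^('m option) \<Rightarrow> ('m::finite option \<Rightarrow> real \<Rightarrow> real^3 \<Rightarrow> real)
     \<Rightarrow> (real^3 \<Rightarrow> real) \<Rightarrow> (real^3 \<Rightarrow> real^'m) \<Rightarrow> real^3 \<Rightarrow> real" where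
  "dissipation b F R s x = (\<Sum>i\<in>UNIV. \<Sum>j\<in>UNIV. Dmat b (completed_profile R s x) $ i $ j *
     (grad (red_var_deriv F R s i) x \<bullet> grad (red_var_deriv F R s j) x))"

definition lyapunov_identity ::
  "real \<Rightarrow> real^('m option)^('m option) \<Rightarrow> ('m::finite option \<Rightarrow> real \<Rightarrow> real^3 \<Rightarrow> real)
     \<Rightarrow> (real^3 \<Rightarrow> real) \<Rightarrow> real set \<Rightarrow> (real \<Rightarrow> real^3 \<Rightarrow> real^'m) \<Rightarrow> bool" where
  "lyapunov_identity \<epsilon> b F R I s \<longleftrightarrow> (\<forall>t\<in>I.
     integrable lborel (dissipation b F R (s t)) \<and>
     ((\<lambda>a. red_energy F R (s a)) has_real_derivative
        - \<epsilon> * (LINT x|lborel. dissipation b F R (s t) x)) (at t) \<and>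
     - \<epsilon> * (LINT x|lborel. dissipation b F R (s t) x) \<le> 0)"

definition positive_state :: "real set \<Rightarrow> (real \<Rightarrow> real^3 \<Rightarrow> real^('k::finite)) \<Rightarrow> bool" where
  "positive_state I \<sigma> \<longleftrightarrow> (\<forall>t\<in>I. \<forall>x i. 0 < \<sigma> t x $ i)"

definition smooth_state :: "real set \<Rightarrow> (real \<Rightarrow> real^3 \<Rightarrow> real^('k::finite)) \<Rightarrow> bool" where
  "smooth_state I \<sigma> \<longleftrightarrow> Ck_on 4 (I \<times> UNIV) (\<lambda>(t, x). \<sigma> t x)"

text \<open>
  The decay at infinity that gives a meaning to the energy, lets it be differentiated under the
  integral and removes the boundary terms. The densities themselves need not tend to zero, only
  the fields in the integrals are restricted. In the last field, the flux \<open>red_flux\<close> is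
  $-\rho_i u_i / \varepsilon$ when \<open>\<sigma>\<close> solves the original system with \<open>v = 0\<close>, so that this field
  is $-\varepsilon^{-1} \sum_{i=1}^n \frac{\delta E}{\delta\rho_i} \rho_i u_i$.
\<close>

definition decaying ::
  "real^('m option)^('m option) \<Rightarrow> ('m::finite option \<Rightarrow> real \<Rightarrow> real^3 \<Rightarrow> real)
     \<Rightarrow> real set \<Rightarrow> (real \<Rightarrow> real^3 \<Rightarrow> real^('m option)) \<Rightarrow> bool" where
  "decaying b F I \<sigma> \<longleftrightarrow> (\<forall>t\<in>I.
     integrable lborel (\<lambda>x. energy_density F (\<sigma> t x) (grads (\<sigma> t) x)) \<and>
     (\<exists>\<delta>>0. \<exists>g. integrable lborel g \<and> (\<forall>s\<in>I. \<forall>x. \<bar>s - t\<bar> < \<delta> \<longrightarrow>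
        \<bar>deriv (\<lambda>a. energy_density F (\<sigma> a x) (grads (\<sigma> a) x)) s\<bar> \<le> g x)) \<and>
     W11 (\<lambda>x. \<Sum>i\<in>UNIV. deriv (\<lambda>a. \<sigma> a x $ i) t *\<^sub>R dF_dq F (\<sigma> t) i x) \<and>
     W11 (\<lambda>x. \<Sum>j\<in>UNIV. red_var_deriv F (total_density (\<sigma> t)) (reduced_profile (\<sigma> t)) j x *\<^sub>R
                red_flux b F (total_density (\<sigma> t)) (reduced_profile (\<sigma> t)) j x))"

end

theory Submission
  imports Defs
begin

text \<open>
  The Maxwell-Stefan relations and the constraint \<open>\<Sum>\<^sub>j \<rho>\<^sub>j u\<^sub>j = 0\<close> can be
  inverted by linear algebra alone. In terms of \<open>w\<^sub>j = u\<^sub>j - u\<^sub>n\<close> and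
  \<open>g\<^sub>j = \<nabla>(\<delta>E/\<delta>\<rho>\<^sub>j - \<delta>E/\<delta>\<rho>\<^sub>n)\<close> they read \<open>\<tau> w = - \<epsilon> Q\<^sup>-\<^sup>1 g\<close>, and the fluxes are
  \<open>\<rho>\<^sub>i u\<^sub>i = (Q\<^sup>-\<^sup>1 w)\<^sub>i\<close>; hence \<open>\<rho>\<^sub>i u\<^sub>i = - \<epsilon> (D g)\<^sub>i\<close> for \<open>i < n\<close> (\<open>maxwell_stefan_inversion\<close>).
  On the other hand \<open>\<delta>E/\<delta>\<rho>\<^sub>j - \<delta>E/\<delta>\<rho>\<^sub>n\<close> is the variational derivative of the reduced energy, since
  varying \<open>\<rho>\<^sub>j\<close> at fixed total density exchanges species \<open>j\<close> for species \<open>n\<close>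
  (\<open>red_var_deriv_eq\<close>). With \<open>v = 0\<close> the mass equations then become the reduced system, and their
  sum, the divergence of \<open>- \<Sum>\<^sub>i \<rho>\<^sub>i u\<^sub>i = 0\<close>, shows that the total density is constant in time.

  The quadratic form of the friction matrix is
  \<open>1/2 \<Sum>\<^sub>i\<^sub>j b\<^sub>i\<^sub>j \<rho>\<^sub>i \<rho>\<^sub>j (z\<^sub>i - z\<^sub>j)\<^sup>2\<close>, so by condition (N) it vanishes on the constants only and the
  submatrix \<open>\<tau>\<close> is positive definite. The same computation with all \<open>b\<^sub>i\<^sub>j = 1\<close> applies to \<open>Q\<^sup>-\<^sup>1\<close>, and
  \<open>D = Q\<^sup>-\<^sup>1 \<tau>\<^sup>-\<^sup>1 Q\<^sup>-\<^sup>1\<close> is congruent to \<open>\<tau>\<^sup>-\<^sup>1\<close> (\<open>pos_def_Dmat\<close>). The reduced Hessian \<open>H\<close> is the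
  full one restricted to the vectors with sum zero (\<open>red_energy_hessian_form\<close>), hence positive
  definite, and \<open>D H\<close> is symmetric and positive for the inner product given by \<open>H\<close>; its
  eigenvalues are therefore real and positive (\<open>eigenvalue_pos_def_product\<close>).

  For the Lyapunov property, the energy may be differentiated under the integral, because a local bound on
  the time derivative of its density is integrable (\<open>has_real_derivative_integral\<close>). Pointwise,
  this time derivative is
  \<open>\<Sum>\<^sub>i \<partial>\<^sub>t\<rho>\<^sub>i \<delta>E/\<delta>\<rho>\<^sub>i\<close> plus a divergence (\<open>energy_density_time_derivative\<close>; here time and space
  derivatives are exchanged), and inserting the reduced system and using the product rule once more
  turns it into \<open>- \<epsilon>\<close> times the dissipation plus divergences. The divergences are those of fields
  in \<open>W\<^sup>1\<^sup>,\<^sup>1\<close> and integrate to zero (\<open>integral_divergence_zero\<close>).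

  These computations need continuous derivatives of the potentials and of the fluxes. They
  are supplied by a calculus for \<open>Ck_on\<close>: closure under products, composition and, through Cramer's
  rule, matrix inversion.
\<close>

section \<open>Calculus of continuously differentiable maps\<close>

lemma frechet_derivativeI:
  "(f has_derivative f') (at x) \<Longrightarrow> frechet_derivative f (at x) = f'"
  by (rule frechet_derivative_at[symmetric])

lemma has_derivative_frechet:
  "f differentiable (at x) \<Longrightarrow> (f has_derivative frechet_derivative f (at x)) (at x)"
  by (simp add: frechet_derivative_works)

text \<open>The derivative at a point of an open set depends on the values in that set only.\<close>

lemma Ck_on_cong:
  assumes "open S" and "\<And>x. x \<in> S \<Longrightarrow> f x = g x" and "Ck_on k S f"
  shows "Ck_on k S g"
  using assms(2,3)
proof (induction k arbitrary: f g)
  case 0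
  then show ?case by (simp cong: continuous_on_cong)
next
  case (Suc k)
  have d: "(g has_derivative frechet_derivative f (at x)) (at x)" if "x \<in> S" for x
    by (rule has_derivative_transform_within_open[OF _ assms(1) that Suc.prems(1)])
      (use Suc.prems(2) that in \<open>auto simp: has_derivative_frechet\<close>)
  have "Ck_on k S (\<lambda>x. frechet_derivative g (at x) h)" for h
  proof (rule Suc.IH)
    show "Ck_on k S (\<lambda>x. frechet_derivative f (at x) h)" using Suc.prems(2) by simp
  qed (simp add: frechet_derivativeI[OF d])
  then show ?case using d by (auto simp: differentiable_def)
qed

text \<open>The induction step of the closure properties below: it accepts any explicit formula for the
  derivative.\<close>

lemma Ck_on_SucI:
  assumes "open S" and "\<And>x. x \<in> S \<Longrightarrow> (f has_derivative f' x) (at x)"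
    and "\<And>h. Ck_on k S (\<lambda>x. f' x h)"
  shows "Ck_on (Suc k) S f"
proof -
  have "Ck_on k S (\<lambda>x. frechet_derivative f (at x) h)" for h
    by (rule Ck_on_cong[OF assms(1) _ assms(3)[of h]])
      (simp add: frechet_derivativeI[OF assms(2)])
  then show ?thesis using assms(2) by (auto simp: differentiable_def)
qed

lemma Ck_on_has_derivative:
  assumes "Ck_on (Suc k) S f" and "x \<in> S"
  shows "(f has_derivative frechet_derivative f (at x)) (at x)"
  using assms by (simp add: has_derivative_frechet)

lemma Ck_on_derivative: "Ck_on (Suc k) S f \<Longrightarrow> Ck_on k S (\<lambda>x. frechet_derivative f (at x) h)"
  by simp

lemma Ck_on_differentiable: "Ck_on k S f \<Longrightarrow> 0 < k \<Longrightarrow> x \<in> S \<Longrightarrow> f differentiable (at x)"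
  by (cases k) auto

lemma Ck_on_SucD: "Ck_on (Suc k) S f \<Longrightarrow> Ck_on k S f"
proof (induction k arbitrary: f)
  case 0
  then show ?case
    using continuous_at_imp_continuous_on differentiable_imp_continuous_within by fastforce
next
  case (Suc k)
  then show ?case by (metis Ck_on.simps(2))
qed

lemma Ck_on_mono: "Ck_on l S f \<Longrightarrow> k \<le> l \<Longrightarrow> Ck_on k S f"
  by (induction l rule: nat_induct) (use Ck_on_SucD le_Suc_eq in blast)+

lemma Ck_on_const: "open S \<Longrightarrow> Ck_on k S (\<lambda>x. c)"
proof (induction k arbitrary: c)
  case (Suc k)
  then show ?case by (intro Ck_on_SucI[where f' = "\<lambda>x h. 0"]) auto
qed simp

lemma Ck_on_ident: "open S \<Longrightarrow> Ck_on k S (\<lambda>x. x)"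
proof (induction k)
  case (Suc k)
  then show ?case
    by (intro Ck_on_SucI[where f' = "\<lambda>x h. h"]) (auto intro: Ck_on_const)
qed simp

lemma Ck_on_bounded_linear:
  assumes "open S" and "bounded_linear L" and "Ck_on k S f"
  shows "Ck_on k S (\<lambda>x. L (f x))"
  using assms(3)
proof (induction k arbitrary: f)
  case 0
  then show ?case
    using bounded_linear.continuous_on[OF assms(2)] by auto
next
  case (Suc k)
  show ?case
    by (rule Ck_on_SucI[OF assms(1) bounded_linear.has_derivative[OF assms(2)
            Ck_on_has_derivative[OF Suc.prems]]])
      (use Suc in auto)
qed

lemma Ck_on_add:
  assumes "open S" "Ck_on k S f" "Ck_on k S g"
  shows "Ck_on k S (\<lambda>x. f x + g x)"
  using assms(2,3)
proof (induction k arbitrary: f g)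
  case 0
  then show ?case by (auto intro: continuous_intros)
next
  case (Suc k)
  show ?case
    by (rule Ck_on_SucI[OF assms(1) has_derivative_add[OF
            Ck_on_has_derivative[OF Suc.prems(1)] Ck_on_has_derivative[OF Suc.prems(2)]]])
      (use Suc in auto)
qed

lemma Ck_on_minus: "open S \<Longrightarrow> Ck_on k S f \<Longrightarrow> Ck_on k S (\<lambda>x. - f x)"
  by (rule Ck_on_bounded_linear[of S uminus]) (auto intro: bounded_linear_minus bounded_linear_ident)

lemma Ck_on_diff:
  "open S \<Longrightarrow> Ck_on k S f \<Longrightarrow> Ck_on k S g \<Longrightarrow> Ck_on k S (\<lambda>x. f x - g x)"
  using Ck_on_add[of S k f "\<lambda>x. - g x"] Ck_on_minus[of S k g] by simp

lemma Ck_on_sum: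
  "open S \<Longrightarrow> (\<And>i. i \<in> A \<Longrightarrow> Ck_on k S (f i)) \<Longrightarrow> Ck_on k S (\<lambda>x. \<Sum>i\<in>A. f i x)"
  by (induction A rule: infinite_finite_induct) (auto intro: Ck_on_const Ck_on_add)

lemma Ck_on_bilinear:
  assumes "bounded_bilinear B" and "open S" "Ck_on k S f" "Ck_on k S g"
  shows "Ck_on k S (\<lambda>x. B (f x) (g x))"
  using assms(3,4)
proof (induction k arbitrary: f g)
  case 0
  then show ?case by (auto intro: bounded_bilinear.continuous_on[OF assms(1)])
next
  case (Suc k)
  have "Ck_on k S (\<lambda>x. B (f x) (frechet_derivative g (at x) h) + B (frechet_derivative f (at x) h) (g x))" for h
    by (intro Ck_on_add assms Suc.IH Ck_on_derivative Suc.prems Ck_on_SucD[OF Suc.prems(1)]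
        Ck_on_SucD[OF Suc.prems(2)])
  from Ck_on_SucI[OF assms(2) bounded_bilinear.FDERIV[OF assms(1)
            Ck_on_has_derivative[OF Suc.prems(1)] Ck_on_has_derivative[OF Suc.prems(2)]] this]
  show ?case .
qed

lemmas Ck_on_mult = Ck_on_bilinear[OF bounded_bilinear_mult]
lemmas Ck_on_scaleR = Ck_on_bilinear[OF bounded_bilinear_scaleR]
lemmas Ck_on_inner = Ck_on_bilinear[OF bounded_bilinear_inner]

lemma Ck_on_prod:
  fixes f :: "'i \<Rightarrow> 'a::euclidean_space \<Rightarrow> 'b::real_normed_field"
  shows "open S \<Longrightarrow> (\<And>i. i \<in> A \<Longrightarrow> Ck_on k S (f i)) \<Longrightarrow> Ck_on k S (\<lambda>x. \<Prod>i\<in>A. f i x)"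
  by (induction A rule: infinite_finite_induct) (auto intro: Ck_on_const Ck_on_mult)

text \<open>The chain rule expands the derivative of the composition along a basis of the intermediate
  space, which is why that space is Euclidean: \<open>Ck_on\<close> only speaks about derivatives in fixed
  directions.\<close>

lemma Ck_on_compose:
  fixes f :: "'a::euclidean_space \<Rightarrow> 'b::euclidean_space"
    and g :: "'b \<Rightarrow> 'c::real_normed_vector"
  assumes "open S" "Ck_on k S f" "Ck_on k T g" "\<And>x. x \<in> S \<Longrightarrow> f x \<in> T"
  shows "Ck_on k S (\<lambda>x. g (f x))"
  using assms(2,3)
proof (induction k arbitrary: g)
  case 0
  then show ?case
    using assms(4) by (auto intro: continuous_on_compose2)
next
  case (Suc k)
  let ?f' = "\<lambda>x h. \<Sum>b\<in>Basis. (frechet_derivative f (at x) h \<bullet> b) *\<^sub>R frechet_derivative g (at (f x)) b"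
  have "((\<lambda>x. g (f x)) has_derivative ?f' x) (at x)" if x: "x \<in> S" for x
  proof -
    have g: "(g has_derivative frechet_derivative g (at (f x))) (at (f x))"
      using Suc.prems(2) assms(4)[OF x] by (simp add: has_derivative_frechet)
    have "?f' x = (\<lambda>h. frechet_derivative g (at (f x)) (frechet_derivative f (at x) h))"
    proof
      fix h
      interpret G: bounded_linear "frechet_derivative g (at (f x))"
        using g by (rule has_derivative_bounded_linear)
      show "?f' x h = frechet_derivative g (at (f x)) (frechet_derivative f (at x) h)"
        by (subst (3) euclidean_representation[symmetric]) (simp only: G.sum G.scaleR)
    qed
    then show ?thesis
      using has_derivative_compose[OF Ck_on_has_derivative[OF Suc.prems(1) x] g] by simp
  qed
  moreover have "Ck_on k S (\<lambda>x. ?f' x h)" for h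
    using Suc.prems
    by (intro Ck_on_sum Ck_on_scaleR Ck_on_inner Suc.IH Ck_on_const assms(1) Ck_on_derivative
        Ck_on_SucD[OF Suc.prems(1)])
  ultimately show ?case by (intro Ck_on_SucI[OF assms(1)])
qed

lemma Ck_on_inverse: "Ck_on k (- {0}) (inverse :: real \<Rightarrow> real)"
proof (induction k)
  case 0
  show ?case by (auto intro: continuous_intros)
next
  case (Suc k)
  show ?case
    by (rule Ck_on_SucI[where f' = "\<lambda>x h. - (inverse x * h * inverse x)"])
      (auto intro!: has_derivative_inverse' Ck_on_minus Ck_on_mult Suc Ck_on_const open_Compl)
qed

lemma Ck_on_divide:
  fixes f g :: "'a::euclidean_space \<Rightarrow> real"
  assumes "open S" "Ck_on k S f" "Ck_on k S g" "\<And>x. x \<in> S \<Longrightarrow> g x \<noteq> 0"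
  shows "Ck_on k S (\<lambda>x. f x / g x)"
  unfolding divide_inverse
  by (intro Ck_on_mult assms Ck_on_compose[OF assms(1,3) Ck_on_inverse]) (use assms(4) in auto)

lemma Ck_on_Pair:
  assumes "open S" "Ck_on k S f" "Ck_on k S g"
  shows "Ck_on k S (\<lambda>x. (f x, g x))"
proof -
  have "bounded_linear (\<lambda>a. (a, 0))" "bounded_linear (\<lambda>b. (0, b))"
    by (intro bounded_linear_Pair bounded_linear_ident bounded_linear_zero)+
  then have "Ck_on k S (\<lambda>x. (f x, 0) + (0, g x))"
    using assms by (intro Ck_on_add Ck_on_bounded_linear[of S "\<lambda>a. (a, 0)"]
        Ck_on_bounded_linear[of S "\<lambda>b. (0, b)"])
  then show ?thesis by simp
qed

lemma bounded_linear_axis: "bounded_linear (axis i :: 'b::real_normed_vector \<Rightarrow> 'b^'n::finite)"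
proof (rule bounded_linear_intro[where K = 1])
  fix x :: 'b
  have "norm (axis i x :: 'b^'n) = sqrt (\<Sum>j\<in>UNIV. if j = i then (norm x)\<^sup>2 else 0)"
    unfolding norm_vec_def L2_set_def axis_def by (intro arg_cong[of _ _ sqrt] sum.cong) auto
  then show "norm (axis i x :: 'b^'n) \<le> norm x * 1" by simp
qed (auto simp: vec_eq_iff axis_def)

lemma Ck_on_vec_nth: "open S \<Longrightarrow> Ck_on k S f \<Longrightarrow> Ck_on k S (\<lambda>x. f x $ i)"
  by (rule Ck_on_bounded_linear[where L = "\<lambda>v. v $ i"]) (auto intro: bounded_linear_vec_nth)

lemma Ck_on_vec_lambda:
  fixes f :: "'a::euclidean_space \<Rightarrow> 'n::finite \<Rightarrow> 'b::real_normed_vector"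
  assumes "open S" "\<And>i. Ck_on k S (\<lambda>x. f x i)"
  shows "Ck_on k S (\<lambda>x. \<chi> i. f x i)"
proof -
  have "(\<chi> i. f x i) = (\<Sum>i\<in>UNIV. axis i (f x i))" for x
    by (auto simp: vec_eq_iff axis_def if_distrib cong: if_cong)
  moreover have "Ck_on k S (\<lambda>x. \<Sum>i\<in>UNIV. axis i (f x i))"
    using assms by (intro Ck_on_sum Ck_on_bounded_linear[OF assms(1) bounded_linear_axis])
  ultimately show ?thesis by simp
qed

lemma Ck_on_det:
  fixes A :: "'a::euclidean_space \<Rightarrow> real^'n^'n"
  assumes "open S" "\<And>i j. Ck_on k S (\<lambda>x. A x $ i $ j)"
  shows "Ck_on k S (\<lambda>x. det (A x))"
  unfolding det_def using assms by (intro Ck_on_sum Ck_on_mult Ck_on_prod Ck_on_const)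

lemma matrix_inv_inverse:
  assumes "invertible A"
  shows "A ** matrix_inv A = mat 1" "matrix_inv A ** A = mat 1"
  using someI_ex[OF assms[unfolded invertible_def]] unfolding matrix_inv_def by auto

text \<open>By Cramer's rule the entries of the inverse are quotients of determinants.\<close>

lemma Ck_on_matrix_inv:
  fixes A :: "'a::euclidean_space \<Rightarrow> real^'n^'n"
  assumes S: "open S" and A: "\<And>i j. Ck_on k S (\<lambda>x. A x $ i $ j)"
    and inv: "\<And>x. x \<in> S \<Longrightarrow> invertible (A x)"
  shows "Ck_on k S (\<lambda>x. matrix_inv (A x) $ i $ j)"
proof -
  let ?N = "\<lambda>x. \<chi> p q. if q = i then axis j 1 $ p else A x $ p $ q"
  have "det (?N x) / det (A x) = matrix_inv (A x) $ i $ j" if "x \<in> S" for x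
  proof -
    have "A x *v (matrix_inv (A x) *v axis j 1) = axis j 1"
      using inv[OF that] by (simp add: matrix_vector_mul_assoc matrix_inv_inverse)
    then have "(matrix_inv (A x) *v axis j 1) $ i = det (?N x) / det (A x)"
      using inv[OF that] by (subst (asm) cramer) (auto simp: invertible_det_nz)
    then show ?thesis by (simp add: matrix_vector_mult_basis column_def)
  qed
  moreover have "Ck_on k S (\<lambda>x. det (?N x) / det (A x))"
  proof (intro Ck_on_divide Ck_on_det S A)
    show "Ck_on k S (\<lambda>x. ?N x $ p $ q)" for p q
      using A Ck_on_const[OF S] by (cases "q = i") simp_all
  qed (use inv in \<open>simp add: invertible_det_nz\<close>)
  ultimately show ?thesis by (rule Ck_on_cong[OF S])
qed

subsection \<open>Equality of mixed derivatives\<close>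

lemma Ck_on_line_derivative:
  assumes "Ck_on (Suc k) S f" and "x + a *\<^sub>R h \<in> S"
  shows "((\<lambda>a. f (x + a *\<^sub>R h)) has_vector_derivative
    frechet_derivative f (at (x + a *\<^sub>R h)) h) (at a)"
proof -
  let ?f' = "frechet_derivative f (at (x + a *\<^sub>R h))"
  have f: "(f has_derivative ?f') (at (x + a *\<^sub>R h))"
    by (rule Ck_on_has_derivative[OF assms])
  have "((\<lambda>a. x + a *\<^sub>R h) has_derivative (\<lambda>c. c *\<^sub>R h)) (at a)"
    by (auto intro!: derivative_eq_intros)
  from has_derivative_compose[OF this f]
  show ?thesis
    using linear_cmul[OF has_derivative_linear[OF f]] by (simp add: has_vector_derivative_def)
qed

text \<open>The mean value theorem is applied first in the direction \<open>h\<close> to the difference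
  \<open>f (y + r k) - f y\<close>, then in the direction \<open>k\<close> to the derivative of \<open>f\<close> along \<open>h\<close>.\<close>

lemma second_difference:
  fixes f :: "'a::euclidean_space \<Rightarrow> real"
  assumes S: "open S" and f: "Ck_on 2 S f" and "0 < r"
    and seg: "\<And>a b. 0 \<le> a \<Longrightarrow> a \<le> r \<Longrightarrow> 0 \<le> b \<Longrightarrow> b \<le> r \<Longrightarrow> x + a *\<^sub>R h + b *\<^sub>R k \<in> S"
  obtains a b where "0 < a" "a < r" "0 < b" "b < r"
    "f (x + r *\<^sub>R h + r *\<^sub>R k) - f (x + r *\<^sub>R h) - f (x + r *\<^sub>R k) + f x =
     r * (r * frechet_derivative (\<lambda>y. frechet_derivative f (at y) h) (at (x + a *\<^sub>R h + b *\<^sub>R k)) k)"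
proof -
  let ?Dh = "\<lambda>y. frechet_derivative f (at y) h"
  have f2: "Ck_on (Suc 1) S f" "Ck_on (Suc 0) S ?Dh"
    using f by (auto simp: numeral_2_eq_2 simp del: Ck_on.simps intro: Ck_on_derivative)
  define \<phi> where "\<phi> = (\<lambda>a. f (x + a *\<^sub>R h + r *\<^sub>R k) - f (x + a *\<^sub>R h))"
  have 1: "(\<phi> has_real_derivative (?Dh (x + a *\<^sub>R h + r *\<^sub>R k) - ?Dh (x + a *\<^sub>R h))) (at a)"
    if "0 \<le> a" "a \<le> r" for a
  proof -
    have i: "x + a *\<^sub>R h + r *\<^sub>R k \<in> S" "x + a *\<^sub>R h \<in> S"
      using seg[of a r] seg[of a 0] that \<open>0 < r\<close> by auto
    show ?thesis
      using Ck_on_line_derivative[OF f2(1), of "x + r *\<^sub>R k" a h]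
        Ck_on_line_derivative[OF f2(1), of x a h] i
      unfolding \<phi>_def has_real_derivative_iff_has_vector_derivative
      by (intro has_vector_derivative_diff) (simp_all add: ac_simps)
  qed
  obtain a where a: "0 < a" "a < r"
    "\<phi> r - \<phi> 0 = (r - 0) * (?Dh (x + a *\<^sub>R h + r *\<^sub>R k) - ?Dh (x + a *\<^sub>R h))"
    using MVT2[OF \<open>0 < r\<close> 1] by auto
  have 2: "((\<lambda>b. ?Dh (x + a *\<^sub>R h + b *\<^sub>R k)) has_real_derivative
      frechet_derivative ?Dh (at (x + a *\<^sub>R h + b *\<^sub>R k)) k) (at b)" if "0 \<le> b" "b \<le> r" for b
  proof -
    have i: "x + a *\<^sub>R h + b *\<^sub>R k \<in> S" using seg[of a b] that a by auto
    show ?thesis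
      using Ck_on_line_derivative[OF f2(2) i]
      by (simp add: has_real_derivative_iff_has_vector_derivative)
  qed
  obtain b where b: "0 < b" "b < r"
    "?Dh (x + a *\<^sub>R h + r *\<^sub>R k) - ?Dh (x + a *\<^sub>R h + 0 *\<^sub>R k)
      = (r - 0) * frechet_derivative ?Dh (at (x + a *\<^sub>R h + b *\<^sub>R k)) k"
    using MVT2[OF \<open>0 < r\<close> 2] by auto
  show thesis
    using that[OF a(1,2) b(1,2)] a(3) b(3) by (simp add: \<phi>_def)
qed

text \<open>Both iterated derivatives are the limit of the same symmetric second difference.\<close>

lemma mixed_derivatives_commute:
  fixes f :: "'a::euclidean_space \<Rightarrow> real"
  assumes S: "open S" and f: "Ck_on 2 S f" and x: "x \<in> S"
  shows "frechet_derivative (\<lambda>y. frechet_derivative f (at y) h) (at x) k =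
         frechet_derivative (\<lambda>y. frechet_derivative f (at y) k) (at x) h"
proof -
  let ?D = "\<lambda>h k y. frechet_derivative (\<lambda>y. frechet_derivative f (at y) h) (at y) k"
  have "\<bar>?D h k x - ?D k h x\<bar> \<le> 0 + e" if "e > 0" for e
  proof -
    have "continuous_on S (?D h k)" "continuous_on S (?D k h)"
      using f by (auto simp: numeral_2_eq_2)
    then have "isCont (?D h k) x" "isCont (?D k h) x"
      using S x continuous_on_eq_continuous_at by blast+
    then have "\<forall>\<^sub>F y in at x. dist (?D h k y) (?D h k x) < e / 2"
      "\<forall>\<^sub>F y in at x. dist (?D k h y) (?D k h x) < e / 2"
      using that half_gt_zero unfolding isCont_def tendsto_iff by blast+
    moreover have "\<forall>\<^sub>F y in at x. y \<in> S"
      using S x by (metis eventually_at_topological)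
    ultimately have "\<forall>\<^sub>F y in at x. y \<in> S \<and> dist (?D h k y) (?D h k x) < e / 2 \<and>
        dist (?D k h y) (?D k h x) < e / 2"
      by eventually_elim auto
    then obtain d where d: "d > 0"
      "\<And>y. y \<noteq> x \<Longrightarrow> dist y x < d \<Longrightarrow> y \<in> S \<and> dist (?D h k y) (?D h k x) < e / 2 \<and>
         dist (?D k h y) (?D k h x) < e / 2"
      by (auto simp: eventually_at)
    have d': "y \<in> S" "dist (?D h k y) (?D h k x) < e / 2" "dist (?D k h y) (?D k h x) < e / 2"
      if "dist y x < d" for y
      using d(2)[of y] that x \<open>e > 0\<close> by (cases "y = x"; auto)+
    \<comment> \<open>The parallelogram with sides \<open>r h\<close> and \<open>r k\<close> at \<open>x\<close> lies within distance \<open>d / 2\<close> of \<open>x\<close>.\<close>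
    define r where "r = d / (2 * (norm h + norm k + 1))"
    have nn: "norm h + norm k + 1 > 0" by (intro add_nonneg_pos) auto
    then have "r > 0" using d(1) unfolding r_def by (intro divide_pos_pos mult_pos_pos) auto
    have near: "dist (x + a *\<^sub>R h + b *\<^sub>R k) x < d" if "0 \<le> a" "a \<le> r" "0 \<le> b" "b \<le> r" for a b
    proof -
      have "dist (x + a *\<^sub>R h + b *\<^sub>R k) x = norm (a *\<^sub>R h + b *\<^sub>R k)"
        by (simp add: dist_norm)
      also have "\<dots> \<le> a * norm h + b * norm k"
        using norm_triangle_ineq[of "a *\<^sub>R h" "b *\<^sub>R k"] that by simp
      also have "\<dots> \<le> r * norm h + r * norm k"
        using that by (intro add_mono mult_right_mono) auto
      also have "\<dots> \<le> r * (norm h + norm k + 1)" using \<open>r > 0\<close> by (simp add: algebra_simps)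
      also have "\<dots> = d / 2"
        unfolding r_def using nn by (simp add: divide_simps)
      finally show ?thesis using d(1) by simp
    qed
    obtain a b where ab: "0 < a" "a < r" "0 < b" "b < r"
      "f (x + r *\<^sub>R h + r *\<^sub>R k) - f (x + r *\<^sub>R h) - f (x + r *\<^sub>R k) + f x
        = r * (r * ?D h k (x + a *\<^sub>R h + b *\<^sub>R k))"
      using second_difference[OF S f \<open>r > 0\<close>, of x h k] near d'(1) by metis
    have near': "dist (x + a *\<^sub>R k + b *\<^sub>R h) x < d" if "0 \<le> a" "a \<le> r" "0 \<le> b" "b \<le> r" for a b
      using near[of b a] that by (simp add: add.commute add.left_commute)
    obtain a' b' where ab': "0 < a'" "a' < r" "0 < b'" "b' < r"
      "f (x + r *\<^sub>R k + r *\<^sub>R h) - f (x + r *\<^sub>R k) - f (x + r *\<^sub>R h) + f x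
        = r * (r * ?D k h (x + a' *\<^sub>R k + b' *\<^sub>R h))"
      using second_difference[OF S f \<open>r > 0\<close>, of x k h] near' d'(1) by metis
    have swap: "x + r *\<^sub>R k + r *\<^sub>R h = x + r *\<^sub>R h + r *\<^sub>R k" by simp
    have "r * (r * ?D h k (x + a *\<^sub>R h + b *\<^sub>R k)) = r * (r * ?D k h (x + a' *\<^sub>R k + b' *\<^sub>R h))"
      using ab(5) ab'(5) unfolding swap by linarith
    then have "?D h k (x + a *\<^sub>R h + b *\<^sub>R k) = ?D k h (x + a' *\<^sub>R k + b' *\<^sub>R h)"
      using \<open>r > 0\<close> by simp
    moreover have "dist (?D h k (x + a *\<^sub>R h + b *\<^sub>R k)) (?D h k x) < e / 2"
      using d'(2) near[of a b] ab by simp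
    moreover have "dist (?D k h (x + a' *\<^sub>R k + b' *\<^sub>R h)) (?D k h x) < e / 2"
      using d'(3) near'[of a' b'] ab' by simp
    ultimately show ?thesis unfolding dist_real_def by linarith
  qed
  then have "\<bar>?D h k x - ?D k h x\<bar> \<le> 0" by (rule field_le_epsilon)
  then show ?thesis by simp
qed

section \<open>Integrals over the whole space\<close>

lemma lborel_translation:
  fixes g :: "'a::euclidean_space \<Rightarrow> real"
  assumes "integrable lborel g"
  shows "integrable lborel (\<lambda>x. g (x + c))"
    and "(LINT x|lborel. g (x + c)) = (LINT x|lborel. g x)"
proof -
  have "(\<lambda>x. x + c) = (+) c" by (simp add: fun_eq_iff add.commute)
  then have d: "distr lborel borel (\<lambda>x. x + c) = lborel"
    using lborel_distr_plus[of c] by simp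
  have "integrable (distr lborel borel (\<lambda>x. x + c)) g" unfolding d by (rule assms)
  then show "integrable lborel (\<lambda>x. g (x + c))"
    by (subst (asm) integrable_distr_eq) (use assms in auto)
  have "(LINT x|distr lborel borel (\<lambda>x. x + c). g x) = (LINT x|lborel. g (x + c))"
    using assms by (intro integral_distr) auto
  then show "(LINT x|lborel. g (x + c)) = (LINT x|lborel. g x)"
    unfolding d by simp
qed

text \<open>The increment \<open>f (x + h) - f x\<close> is the integral of the directional derivative over the
  segment from \<open>x\<close> to \<open>x + h\<close>. Integrated over all \<open>x\<close>, the increment vanishes by translation
  invariance, while by Fubini and the same invariance the other side becomes the integral of the
  derivative. This avoids boundary terms on large balls.\<close>

lemma integral_directional_derivative_zero:
  fixes f :: "'a::euclidean_space \<Rightarrow> real"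
  assumes C1: "Ck_on 1 UNIV f" and f: "integrable lborel f"
    and D: "integrable lborel (\<lambda>x. frechet_derivative f (at x) h)"
  shows "(LINT x|lborel. frechet_derivative f (at x) h) = 0"
proof -
  define D where "D = (\<lambda>x. frechet_derivative f (at x) h)"
  have cont: "continuous_on UNIV D" and C1': "Ck_on (Suc 0) UNIV f"
    using C1 by (auto simp: D_def)
  have intD: "integrable lborel D" using assms(3) by (simp add: D_def)
  let ?G = "\<lambda>(s, x). indicator {0..1::real} s *\<^sub>R D (x + s *\<^sub>R h)"
  have ftc: "(LINT s|lborel. indicator {0..1} s *\<^sub>R D (x + s *\<^sub>R h)) = f (x + h) - f x" for x
  proof -
    have "(LINT s|lborel. indicator {0..1} s *\<^sub>R D (x + s *\<^sub>R h)) = f (x + 1 *\<^sub>R h) - f (x + 0 *\<^sub>R h)"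
    proof (rule integral_FTC_Icc)
      show "((\<lambda>s. f (x + s *\<^sub>R h)) has_vector_derivative D (x + s *\<^sub>R h)) (at s within {0..1})" for s
        using Ck_on_line_derivative[OF C1', of x s h] has_vector_derivative_at_within
        by (auto simp: D_def)
      show "continuous_on {0..1} (\<lambda>s. D (x + s *\<^sub>R h))"
        by (intro continuous_on_compose2[OF cont] continuous_intros) auto
    qed simp
    then show ?thesis by simp
  qed
  have "continuous_on UNIV (\<lambda>p::real \<times> 'a. D (snd p + fst p *\<^sub>R h))"
    by (intro continuous_on_compose2[OF cont] continuous_intros) auto
  then have "(\<lambda>p::real \<times> 'a. D (snd p + fst p *\<^sub>R h)) \<in> borel_measurable (lborel \<Otimes>\<^sub>M lborel)"
    by (simp add: lborel_prod borel_measurable_continuous_onI)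
  then have meas: "?G \<in> borel_measurable (lborel \<Otimes>\<^sub>M lborel)"
    unfolding case_prod_beta by measurable
  have "integrable (lborel \<Otimes>\<^sub>M lborel) ?G"
  proof (rule lborel_pair.Fubini_integrable[OF meas])
    have "integrable lborel (\<lambda>s. indicator {0..1::real} s *\<^sub>R (LINT x|lborel. \<bar>D x\<bar>))"
      by (rule integrable_real_indicator[THEN integrable_scaleR_left]) auto
    moreover have "(LINT x|lborel. norm (?G (s, x))) = indicator {0..1} s *\<^sub>R (LINT x|lborel. \<bar>D x\<bar>)" for s
      using lborel_translation(2)[of "\<lambda>x. \<bar>D x\<bar>" "s *\<^sub>R h"] intD
      by (simp add: abs_mult)
    ultimately show "integrable lborel (\<lambda>s. LINT x|lborel. norm (?G (s, x)))" by simp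
    show "AE s in lborel. integrable lborel (\<lambda>x. ?G (s, x))"
      using lborel_translation(1)[OF intD] by simp
  qed
  then have "(LINT x|lborel. LINT s|lborel. indicator {0..1::real} s *\<^sub>R D (x + s *\<^sub>R h))
      = (LINT s|lborel. LINT x|lborel. indicator {0..1} s *\<^sub>R D (x + s *\<^sub>R h))"
    by (rule lborel_pair.Fubini_integral)
  also have "\<dots> = (LINT s|lborel. indicator {0..1::real} s *\<^sub>R (LINT x|lborel. D x))"
    using lborel_translation(2)[OF intD] by simp
  also have "\<dots> = (LINT x|lborel. D x)" by simp
  finally have "(LINT x|lborel. D x) = (LINT x|lborel. f (x + h) - f x)"
    unfolding ftc by simp
  also have "\<dots> = 0" using lborel_translation[OF f, of h] f by simp
  finally show ?thesis by (simp add: D_def)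
qed

lemma integral_divergence_zero:
  assumes C1: "Ck_on 1 UNIV w" and w: "W11 w"
  shows "integrable lborel (divergence w)" and "(LINT x|lborel. divergence w x) = 0"
proof -
  have i: "integrable lborel (\<lambda>x. frechet_derivative (\<lambda>y. w y $ k) (at x) (axis l 1))" for k l
    using w by (simp add: W11_def)
  have "integrable lborel (\<lambda>x. w x $ k)" for k
    using w integrable_bounded_linear[OF bounded_linear_vec_nth] by (auto simp: W11_def)
  then have "(LINT x|lborel. frechet_derivative (\<lambda>y. w y $ k) (at x) (axis k 1)) = 0" for k
    by (intro integral_directional_derivative_zero Ck_on_vec_nth C1 i open_UNIV)
  then show "integrable lborel (divergence w)" "(LINT x|lborel. divergence w x) = 0"
    using i by (simp_all add: divergence_def[abs_def])
qed

text \<open>The mean value theorem bounds the difference quotients by \<open>g\<close>, so that dominated convergence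
  applies; the derivative is measurable as their limit.\<close>

lemma has_real_derivative_integral:
  fixes \<phi> \<phi>' :: "real \<Rightarrow> 'a \<Rightarrow> real"
  assumes \<delta>: "0 < \<delta>"
    and int: "\<And>s. \<bar>s - t\<bar> < \<delta> \<Longrightarrow> integrable M (\<phi> s)"
    and der: "\<And>s x. \<bar>s - t\<bar> < \<delta> \<Longrightarrow> ((\<lambda>s. \<phi> s x) has_real_derivative \<phi>' s x) (at s)"
    and bound: "\<And>s x. \<bar>s - t\<bar> < \<delta> \<Longrightarrow> \<bar>\<phi>' s x\<bar> \<le> g x"
    and g: "integrable M g"
  shows "integrable M (\<phi>' t)"
    and "((\<lambda>s. LINT x|M. \<phi> s x) has_real_derivative (LINT x|M. \<phi>' t x)) (at t)"
proof -
  let ?q = "\<lambda>s x. (\<phi> s x - \<phi> t x) / (s - t)"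
  have dom: "\<bar>?q s x\<bar> \<le> g x" if "\<bar>s - t\<bar> < \<delta>" "s \<noteq> t" for s x
  proof -
    have "norm (\<phi> s x - \<phi> t x) \<le> g x * norm (s - t)"
    proof (rule field_differentiable_bound[where S = "ball t \<delta>" and f' = "\<lambda>s. \<phi>' s x"])
      fix r assume "r \<in> ball t \<delta>"
      then have r: "\<bar>r - t\<bar> < \<delta>" by (simp add: dist_real_def)
      show "((\<lambda>s. \<phi> s x) has_real_derivative \<phi>' r x) (at r within ball t \<delta>)"
        by (rule has_field_derivative_at_within[OF der[OF r]])
      show "norm (\<phi>' r x) \<le> g x" using bound[OF r] by simp
    qed (use that \<delta> in \<open>simp_all add: dist_real_def\<close>)
    then show ?thesis using that by (simp add: abs_divide divide_simps)
  qed
  have lim: "(\<lambda>n. ?q (X n) x) \<longlonglongrightarrow> \<phi>' t x" if "\<And>n. X n \<noteq> t" "X \<longlonglongrightarrow> t" for X x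
    using der[of t x] \<delta> that unfolding has_field_derivative_iff tendsto_at_iff_sequentially
    by (auto simp: o_def)
  have *: "integrable M (\<phi>' t) \<and> (\<lambda>n. LINT x|M. ?q (X n) x) \<longlonglongrightarrow> (LINT x|M. \<phi>' t x)"
    if X: "\<And>n. X n \<noteq> t" "X \<longlonglongrightarrow> t" and near: "\<And>n. \<bar>X n - t\<bar> < \<delta>" for X
  proof -
    have m: "?q (X n) \<in> borel_measurable M" for n
      using int[OF near] int[of t] \<delta>
      by (intro borel_measurable_divide borel_measurable_diff borel_measurable_integrable) auto
    have m': "\<phi>' t \<in> borel_measurable M"
      by (rule borel_measurable_LIMSEQ_real[OF lim[OF X] m])
    show ?thesis
      using integrable_dominated_convergence[where s = "\<lambda>n. ?q (X n)", OF m' m g]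
        integral_dominated_convergence[where s = "\<lambda>n. ?q (X n)", OF m' m g]
        lim[OF X] dom[OF near X(1)] by simp
  qed
  \<comment> \<open>Integrability of \<open>\<phi>' t\<close> follows from one sequence of admissible times, here \<open>t + \<delta> / (2 n + 2)\<close>.\<close>
  have "(\<lambda>n. t + \<delta> / 2 * inverse (real (Suc n))) \<longlonglongrightarrow> t + \<delta> / 2 * 0"
    by (intro tendsto_intros LIMSEQ_inverse_real_of_nat)
  moreover have "\<bar>\<delta> / 2 * inverse (real (Suc n))\<bar> < \<delta>" for n
  proof -
    have "\<delta> / 2 * inverse (real (Suc n)) \<le> \<delta> / 2 * 1"
      using \<delta> by (intro mult_left_mono) (auto simp: inverse_le_1_iff)
    then show ?thesis using \<delta> by simp
  qed
  ultimately show "integrable M (\<phi>' t)"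
    using *[of "\<lambda>n. t + \<delta> / 2 * inverse (real (Suc n))"] \<delta> by simp
  show "((\<lambda>s. LINT x|M. \<phi> s x) has_real_derivative (LINT x|M. \<phi>' t x)) (at t)"
    unfolding has_field_derivative_iff tendsto_at_iff_sequentially
  proof (intro allI impI)
    fix X assume X: "\<forall>n. X n \<in> UNIV - {t}" "X \<longlonglongrightarrow> t"
    then obtain N where N: "\<And>n. n \<ge> N \<Longrightarrow> \<bar>X n - t\<bar> < \<delta>"
      using \<delta> unfolding lim_sequentially dist_real_def by blast
    have lim_q: "(\<lambda>n. LINT x|M. ?q (X (n + N)) x) \<longlonglongrightarrow> (LINT x|M. \<phi>' t x)"
    proof (rule *[THEN conjunct2])
      show "X (n + N) \<noteq> t" for n using X(1) by blast
      show "(\<lambda>n. X (n + N)) \<longlonglongrightarrow> t" by (rule LIMSEQ_ignore_initial_segment[OF X(2)])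
      show "\<bar>X (n + N) - t\<bar> < \<delta>" for n by (rule N) simp
    qed
    have q: "(LINT x|M. ?q (X (n + N)) x)
        = ((LINT x|M. \<phi> (X (n + N)) x) - (LINT x|M. \<phi> t x)) / (X (n + N) - t)" for n
      using int[OF N[OF le_add2]] int[of t] \<delta> by simp
    show "((\<lambda>s. ((LINT x|M. \<phi> s x) - (LINT x|M. \<phi> t x)) / (s - t)) \<circ> X)
        \<longlonglongrightarrow> (LINT x|M. \<phi>' t x)"
      by (rule LIMSEQ_offset[where k = N]) (use lim_q in \<open>simp only: q o_def\<close>)
  qed
qed

section \<open>Positive definite matrices\<close>

lemma pos_defI:
  "transpose A = A \<Longrightarrow> (\<And>z. z \<noteq> 0 \<Longrightarrow> 0 < z \<bullet> (A *v z)) \<Longrightarrow> pos_def A"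
  by (simp add: pos_def_def)

lemma pos_def_pos: "pos_def A \<Longrightarrow> z \<noteq> 0 \<Longrightarrow> 0 < z \<bullet> (A *v z)"
  by (simp add: pos_def_def)

lemma pos_def_nonneg: "pos_def A \<Longrightarrow> 0 \<le> z \<bullet> (A *v z)"
  using pos_def_pos[of A z] by (cases "z = 0") auto

lemma pos_def_sym: "pos_def A \<Longrightarrow> transpose A = A"
  by (simp add: pos_def_def)

lemma pos_def_swap:
  assumes "pos_def A"
  shows "y \<bullet> (A *v z) = z \<bullet> (A *v y)"
  using dot_lmul_matrix[of y A z] pos_def_sym[OF assms]
  by (metis inner_commute vector_transpose_matrix)

lemma pos_def_invertible:
  assumes "pos_def A"
  shows "invertible A"
proof -
  have "\<forall>z. A *v z = 0 \<longrightarrow> z = 0" using pos_def_pos[OF assms] by fastforce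
  then show ?thesis by (simp add: invertible_left_inverse matrix_left_invertible_ker)
qed

lemma pos_def_matrix_inv:
  assumes "pos_def A"
  shows "pos_def (matrix_inv A)"
proof (rule pos_defI)
  let ?B = "matrix_inv A"
  note inv = matrix_inv_inverse[OF pos_def_invertible[OF assms]]
  have "A ** transpose ?B = mat 1"
    using arg_cong[OF inv(2), of transpose] pos_def_sym[OF assms]
    by (simp add: matrix_transpose_mul)
  then have "?B ** (A ** transpose ?B) = ?B" by simp
  then show "transpose ?B = ?B" by (simp add: matrix_mul_assoc inv)
  fix z :: "real^'a" assume "z \<noteq> 0"
  have z: "A *v (?B *v z) = z" by (simp add: matrix_vector_mul_assoc inv)
  then have "?B *v z \<noteq> 0" using \<open>z \<noteq> 0\<close> by auto
  from pos_def_pos[OF assms this] show "0 < z \<bullet> (?B *v z)"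
    by (simp add: z inner_commute)
qed

lemma pos_def_congruence:
  assumes "pos_def A" and "pos_def P"
  shows "pos_def (P ** A ** P)"
proof (rule pos_defI)
  show "transpose (P ** A ** P) = P ** A ** P"
    using pos_def_sym[OF assms(1)] pos_def_sym[OF assms(2)]
    by (simp add: matrix_transpose_mul matrix_mul_assoc)
  fix z :: "real^'a" assume "z \<noteq> 0"
  then have "P *v z \<noteq> 0" using pos_def_pos[OF assms(2), of z] by auto
  from pos_def_pos[OF assms(1) this] show "0 < z \<bullet> ((P ** A ** P) *v z)"
    by (subst inner_commute)
      (simp add: matrix_vector_mul_assoc[symmetric] pos_def_swap[OF assms(2), of z] inner_commute)
qed

text \<open>\<open>D ** H\<close> is symmetric for the inner product \<open>\<langle>y, z\<rangle> = y \<bullet> H z\<close>, because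
  \<open>\<langle>y, D H z\<rangle> = (H y) \<bullet> D (H z)\<close>, and it is positive for the same reason. For an eigenvector
  with real part \<open>a\<close> and imaginary part \<open>c\<close>, symmetry kills the imaginary part of the eigenvalue;
  then \<open>a\<close> and \<open>c\<close> are themselves eigenvectors or zero.\<close>

lemma eigenvalue_pos_def_product:
  assumes D: "pos_def D" and H: "pos_def H" and ev: "complex_eigenvalue (D ** H) \<mu>"
  shows "\<mu> \<in> \<real>" and "0 < Re \<mu>"
proof -
  obtain v where v: "v \<noteq> 0" "map_matrix complex_of_real (D ** H) *v v = \<mu> *s v"
    using ev by (auto simp: complex_eigenvalue_def)
  define a where "a = (\<chi> i. Re (v $ i))"
  define c where "c = (\<chi> i. Im (v $ i))"
  let ?S = "\<lambda>z. D *v (H *v z)"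
  have comp: "(\<Sum>j\<in>UNIV. complex_of_real ((D ** H) $ i $ j) * v $ j) = \<mu> * v $ i" for i
    using arg_cong[OF v(2), of "\<lambda>w. w $ i"]
    by (simp add: matrix_vector_mult_def map_matrix_def)
  have Sa: "?S a = Re \<mu> *\<^sub>R a - Im \<mu> *\<^sub>R c"
    using arg_cong[OF comp, of Re]
    unfolding matrix_vector_mul_assoc
    by (simp add: vec_eq_iff a_def c_def matrix_vector_mult_def)
  have Sc: "?S c = Re \<mu> *\<^sub>R c + Im \<mu> *\<^sub>R a"
    using arg_cong[OF comp, of Im]
    unfolding matrix_vector_mul_assoc
    by (simp add: vec_eq_iff a_def c_def matrix_vector_mult_def)
  have form: "y \<bullet> (H *v ?S z) = (H *v y) \<bullet> (D *v (H *v z))" for y z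
    by (simp add: pos_def_swap[OF H, of y] inner_commute)
  have "a \<bullet> (H *v ?S c) = c \<bullet> (H *v ?S a)"
    unfolding form by (rule pos_def_swap[OF D])
  then have "Im \<mu> * (a \<bullet> (H *v a) + c \<bullet> (H *v c)) = 0"
    unfolding Sa Sc
    by (simp add: matrix_vector_right_distrib matrix_vector_mult_diff_distrib
        matrix_vector_mult_scaleR inner_add_right inner_diff_right pos_def_swap[OF H, of c a] algebra_simps)
  moreover have ac: "a \<noteq> 0 \<or> c \<noteq> 0"
    using v(1) by (auto simp: a_def c_def vec_eq_iff complex_eq_iff)
  then have "0 < a \<bullet> (H *v a) + c \<bullet> (H *v c)"
    using pos_def_pos[OF H] pos_def_nonneg[OF H] by (meson add_nonneg_pos add_pos_nonneg)
  ultimately have im: "Im \<mu> = 0" by auto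
  then show "\<mu> \<in> \<real>" by (simp add: complex_is_Real_iff)
  have "0 < Re \<mu>" if z: "z \<noteq> 0" "?S z = Re \<mu> *\<^sub>R z" for z
  proof -
    have "H *v z \<noteq> 0" using pos_def_pos[OF H z(1)] by auto
    then have "0 < (H *v z) \<bullet> ?S z" by (rule pos_def_pos[OF D])
    then have "0 < Re \<mu> * (z \<bullet> (H *v z))" by (simp add: z(2) inner_commute)
    then show ?thesis using pos_def_pos[OF H z(1)] by (simp add: zero_less_mult_iff)
  qed
  then show "0 < Re \<mu>" using ac Sa Sc im by auto
qed

section \<open>The Maxwell-Stefan diffusion matrix\<close>

lemma sum_option:
  fixes f :: "'m::finite option \<Rightarrow> 'a::comm_monoid_add"
  shows "(\<Sum>i\<in>UNIV. f i) = f None + (\<Sum>j\<in>UNIV. f (Some j))"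
  by (simp add: UNIV_option_conv sum.reindex)

lemma sum_diagonal_minus:
  fixes w :: "'k::finite \<Rightarrow> real"
  shows "(\<Sum>j\<in>UNIV. ((if i = j then d else 0) - c j) * w j) = d * w i - (\<Sum>j\<in>UNIV. c j * w j)"
proof -
  have "((if i = j then d else 0) - c j) * w j = (if i = j then d * w j else 0) - c j * w j" for j
    by (simp add: left_diff_distrib)
  then show ?thesis by (simp add: sum_subtractf)
qed

lemma tau_full_mult:
  "(tau_full b r *v z) $ i = (\<Sum>j\<in>UNIV. b $ i $ j * r $ i * r $ j * (z $ i - z $ j))"
  by (simp add: matrix_vector_mult_def tau_full_def sum_diagonal_minus sum_subtractf
      sum_distrib_right right_diff_distrib)

lemma tau_mult_differences:
  "(tau b r *v (\<chi> j. z $ Some j - z $ None)) $ i =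
     (\<Sum>j\<in>UNIV. b $ Some i $ j * r $ Some i * r $ j * (z $ Some i - z $ j))"
proof -
  let ?Z = "\<chi> j. z $ j - z $ None"
  have "(tau b r *v (\<chi> j. z $ Some j - z $ None)) $ i = (tau_full b r *v ?Z) $ Some i"
    by (simp add: matrix_vector_mult_def tau_def sum_option)
  then show ?thesis by (simp add: tau_full_mult)
qed

lemma Qinv_mult_differences:
  assumes "(\<Sum>k\<in>UNIV. r $ k) \<noteq> 0"
  shows "(Qinv r *v (\<chi> j. z $ Some j - z $ None)) $ i =
     r $ Some i * z $ Some i - r $ Some i / (\<Sum>k\<in>UNIV. r $ k) * (\<Sum>j\<in>UNIV. r $ j * z $ j)"
proof -
  let ?R = "\<Sum>k\<in>UNIV. r $ k"
  have s: "(\<Sum>j\<in>UNIV. r $ Some j) = ?R - r $ None"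
    "(\<Sum>j\<in>UNIV. r $ Some j * z $ Some j) = (\<Sum>j\<in>UNIV. r $ j * z $ j) - r $ None * z $ None"
    by (simp_all add: sum_option)
  have "(Qinv r *v (\<chi> j. z $ Some j - z $ None)) $ i =
      r $ Some i * (z $ Some i - z $ None)
      - r $ Some i / ?R * ((\<Sum>j\<in>UNIV. r $ Some j * z $ Some j) - (\<Sum>j\<in>UNIV. r $ Some j) * z $ None)"
    unfolding matrix_vector_mult_def Qinv_def vec_lambda_beta sum_diagonal_minus
    by (simp add: right_diff_distrib diff_divide_distrib sum_subtractf sum_distrib_left
        sum_distrib_right mult_ac)
  then show ?thesis unfolding s using assms by (simp add: field_simps)
qed

lemma symmetric_entries:
  assumes "transpose b = b"
  shows "b $ i $ j = b $ j $ i"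
proof -
  have "b $ i $ j = transpose b $ j $ i" by (simp add: transpose_def)
  with assms show ?thesis by simp
qed

lemma tau_full_quadratic:
  assumes "transpose b = b"
  shows "z \<bullet> (tau_full b r *v z) =
    (\<Sum>i\<in>UNIV. \<Sum>j\<in>UNIV. b $ i $ j * r $ i * r $ j * (z $ i - z $ j)\<^sup>2) / 2"
proof -
  let ?c = "\<lambda>i j. b $ i $ j * r $ i * r $ j"
  have "b $ i $ j = b $ j $ i" for i j
    by (rule symmetric_entries[OF assms])
  then have c: "?c i j = ?c j i" for i j by simp
  have e: "z \<bullet> (tau_full b r *v z) = (\<Sum>i\<in>UNIV. \<Sum>j\<in>UNIV. ?c i j * (z $ i * (z $ i - z $ j)))"
    by (simp add: inner_vec_def tau_full_mult sum_distrib_left mult_ac)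
  also have "\<dots> = (\<Sum>i\<in>UNIV. \<Sum>j\<in>UNIV. ?c i j * (z $ j * (z $ j - z $ i)))"
    by (subst sum.swap) (intro sum.cong refl arg_cong2[where f = times] c)
  finally have "2 * (z \<bullet> (tau_full b r *v z)) =
      (\<Sum>i\<in>UNIV. \<Sum>j\<in>UNIV. ?c i j * (z $ i * (z $ i - z $ j)))
      + (\<Sum>i\<in>UNIV. \<Sum>j\<in>UNIV. ?c i j * (z $ j * (z $ j - z $ i)))"
    using e by simp
  also have "\<dots> = (\<Sum>i\<in>UNIV. \<Sum>j\<in>UNIV. ?c i j * (z $ i - z $ j)\<^sup>2)"
    by (simp add: sum.distrib[symmetric] power2_eq_square algebra_simps)
  finally show ?thesis by simp
qed

text \<open>Setting the last component to zero embeds the reduced vectors into the full space, where the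
  null space of \<open>tau_full b r\<close> consists of the constants; of these, only zero vanishes at the last
  component.\<close>

lemma pos_def_tau:
  fixes b :: "real^('m::finite option)^('m option)"
  assumes sym: "transpose b = b" and nonneg: "\<And>i j. 0 \<le> b $ i $ j" and r: "\<And>i. 0 < r $ i"
    and null: "\<And>z i. tau_full b r *v z = 0 \<Longrightarrow> z $ i = z $ None"
  shows "pos_def (tau b r)"
proof (rule pos_defI)
  have "b $ i $ j = b $ j $ i" for i j
    by (rule symmetric_entries[OF sym])
  then show "transpose (tau b r) = tau b r"
    by (auto simp: vec_eq_iff transpose_def tau_def tau_full_def)
  fix w :: "real^'m" assume w: "w \<noteq> 0"
  define z where "z = (\<chi> i. case i of None \<Rightarrow> 0 | Some j \<Rightarrow> w $ j)"
  have zw: "z $ None = 0" "z $ Some j = w $ j" for j by (simp_all add: z_def)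
  have q: "w \<bullet> (tau b r *v w) = z \<bullet> (tau_full b r *v z)"
    by (simp add: inner_vec_def matrix_vector_mult_def tau_def sum_option zw)
  let ?t = "\<lambda>i j. b $ i $ j * r $ i * r $ j * (z $ i - z $ j)\<^sup>2"
  have t: "0 \<le> ?t i j" for i j
    using nonneg less_imp_le[OF r] by (intro mult_nonneg_nonneg) auto
  have "(\<Sum>i\<in>UNIV. \<Sum>j\<in>UNIV. ?t i j) \<noteq> 0"
  proof
    assume "(\<Sum>i\<in>UNIV. \<Sum>j\<in>UNIV. ?t i j) = 0"
    then have "(\<Sum>j\<in>UNIV. ?t i j) = 0" for i
      using sum_nonneg_eq_0_iff[of UNIV "\<lambda>i. \<Sum>j\<in>UNIV. ?t i j", OF finite sum_nonneg[OF t]]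
      by (simp only: ball_UNIV)
    then have t0: "?t i j = 0" for i j
      using sum_nonneg_eq_0_iff[of UNIV "?t i", OF finite t] by (simp only: ball_UNIV refl simp_thms)
    have "b $ i $ j * r $ i * r $ j * (z $ i - z $ j) = 0" for i j
      using t0[of i j] by simp
    then have "tau_full b r *v z = 0"
      by (simp only: vec_eq_iff tau_full_mult zero_index sum.neutral_const simp_thms)
    from null[OF this] have "w $ j = 0" for j using zw by metis
    with w show False by (simp add: vec_eq_iff)
  qed
  moreover have "0 \<le> (\<Sum>i\<in>UNIV. \<Sum>j\<in>UNIV. ?t i j)" by (intro sum_nonneg t)
  ultimately show "0 < w \<bullet> (tau b r *v w)"
    unfolding q tau_full_quadratic[OF sym] by simp
qed

lemma pos_def_tau_condition_N:
  assumes N: "condition_N b" and r: "\<And>i. 0 < r $ i"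
  shows "pos_def (tau b r)"
proof (rule pos_def_tau)
  fix z i assume "tau_full b r *v z = 0"
  then have "\<forall>i. (\<Sum>j\<in>UNIV. b $ i $ j * r $ i * r $ j * (z $ i - z $ j)) = 0"
    by (simp add: vec_eq_iff tau_full_mult)
  then have "z \<in> span {\<chi> i. 1}" using N r unfolding condition_N_def by blast
  then obtain c where "z = c *\<^sub>R (\<chi> i. 1)" by (auto simp: span_singleton)
  then show "z $ i = z $ None" by simp
qed (use N r in \<open>auto simp: condition_N_def\<close>)

text \<open>Up to the factor \<open>1/\<rho>\<close>, \<open>\<rho>\<close> the total density, \<open>Qinv\<close> is the friction matrix \<open>tau\<close> of a mixture all of whose
  coefficients \<open>b\<^sub>i\<^sub>j\<close> are 1, so that its definiteness is a special case.\<close>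

lemma pos_def_Qinv:
  fixes r :: "real^('m::finite option)"
  assumes r: "\<And>i. 0 < r $ i"
  shows "pos_def (Qinv r)"
proof -
  let ?R = "\<Sum>k\<in>UNIV. r $ k"
  let ?b = "(\<chi> i j. 1) :: real^('m option)^('m option)"
  have R: "0 < ?R" by (intro sum_pos r) auto
  have tau: "pos_def (tau ?b r)"
  proof (rule pos_def_tau)
    fix z i assume z: "tau_full ?b r *v z = 0"
    have row: "(tau_full ?b r *v z) $ i = r $ i * (?R * z $ i - (\<Sum>j\<in>UNIV. r $ j * z $ j))" for i
      by (simp add: tau_full_mult right_diff_distrib sum_subtractf sum_distrib_left
          sum_distrib_right mult_ac)
    have "?R * z $ i = (\<Sum>j\<in>UNIV. r $ j * z $ j)" for i
      using z r[of i] row[of i] by simp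
    then show "z $ i = z $ None" using R mult_left_cancel[of ?R "z $ i" "z $ None"] by simp
  qed (use r in \<open>auto simp: vec_eq_iff transpose_def\<close>)
  have "tau ?b r = ?R *\<^sub>R Qinv r"
    using R by (auto simp: vec_eq_iff tau_def tau_full_def Qinv_def right_diff_distrib
        sum_distrib_left[symmetric] mult.commute[of ?R])
  then have "Qinv r = (1 / ?R) *\<^sub>R tau ?b r" using R by simp
  moreover have "pos_def ((1 / ?R) *\<^sub>R tau ?b r)"
    using tau R unfolding pos_def_def
    by (simp add: transpose_scalar scaleR_matrix_vector_assoc[symmetric])
  ultimately show ?thesis by simp
qed

lemma pos_def_Dmat:
  assumes "condition_N b" and "\<And>i. 0 < r $ i"
  shows "pos_def (Dmat b r)"
  unfolding Dmat_def
  by (intro pos_def_congruence pos_def_matrix_inv pos_def_tau_condition_N pos_def_Qinv assms)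

text \<open>The relations for \<open>u\<close> involve only differences of velocities and of driving potentials, which
  turns the singular system into the invertible one \<open>\<tau> w = - \<epsilon> Qinv g'\<close>, with \<open>w\<close> and \<open>g'\<close> the
  differences to the last component. By the constraint, the fluxes are the components of \<open>Qinv w\<close>.\<close>

lemma maxwell_stefan_inversion:
  fixes r u g :: "real^('m::finite option)"
  assumes N: "condition_N b" and r: "\<And>i. 0 < r $ i"
    and ms: "\<And>i. - (\<Sum>j\<in>UNIV. b $ i $ j * r $ i * r $ j * (u $ i - u $ j)) =
      \<epsilon> * (r $ i * g $ i - r $ i / (\<Sum>k\<in>UNIV. r $ k) * (\<Sum>j\<in>UNIV. r $ j * g $ j))"
    and mean: "(\<Sum>j\<in>UNIV. r $ j * u $ j) = 0"
  shows "r $ Some i * u $ Some i = - \<epsilon> * (\<Sum>j\<in>UNIV. Dmat b r $ i $ j * (g $ Some j - g $ None))"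
proof -
  let ?w = "\<chi> j. u $ Some j - u $ None"
  let ?g = "\<chi> j. g $ Some j - g $ None"
  have R: "(\<Sum>k\<in>UNIV. r $ k) \<noteq> 0" using r by (metis sum_pos finite UNIV_not_empty less_irrefl)
  have eq: "tau b r *v ?w = - \<epsilon> *\<^sub>R (Qinv r *v ?g)"
  proof (rule iffD2[OF vec_eq_iff], rule)
    fix i show "(tau b r *v ?w) $ i = (- \<epsilon> *\<^sub>R (Qinv r *v ?g)) $ i"
      using ms[of "Some i"] by (simp add: tau_mult_differences Qinv_mult_differences[OF R])
  qed
  have "matrix_inv (tau b r) *v (tau b r *v ?w) = - \<epsilon> *\<^sub>R (matrix_inv (tau b r) *v (Qinv r *v ?g))"
    by (simp only: eq matrix_vector_mult_scaleR)
  then have w: "?w = - \<epsilon> *\<^sub>R (matrix_inv (tau b r) *v (Qinv r *v ?g))"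
    using matrix_inv_inverse(2)[OF pos_def_invertible[OF pos_def_tau_condition_N[OF N r]]]
    by (simp add: matrix_vector_mul_assoc)
  have "Qinv r *v ?w = - \<epsilon> *\<^sub>R (Dmat b r *v ?g)"
    by (subst w) (simp only: Dmat_def matrix_vector_mult_scaleR matrix_vector_mul_assoc
        matrix_mul_assoc)
  from arg_cong[OF this, of "\<lambda>v. v $ i"] show ?thesis
    by (simp add: Qinv_mult_differences[OF R] mean) (simp add: matrix_vector_mult_def)
qed

lemma Ck_on_Dmat:
  fixes r :: "'a::euclidean_space \<Rightarrow> real^('m::finite option)"
  assumes S: "open S" and r: "Ck_on k S r" and N: "condition_N b"
    and pos: "\<And>x i. x \<in> S \<Longrightarrow> 0 < r x $ i"
  shows "Ck_on k S (\<lambda>x. Dmat b (r x) $ i $ j)"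
proof -
  have ri: "Ck_on k S (\<lambda>x. r x $ i)" for i by (rule Ck_on_vec_nth[OF S r])
  have z: "Ck_on k S (\<lambda>x. if P then f x else 0)" if "Ck_on k S f" for P and f :: "'a \<Rightarrow> real"
    using that Ck_on_const[OF S] by (cases P) simp_all
  have t: "Ck_on k S (\<lambda>x. tau b (r x) $ i $ j)" for i j
    unfolding tau_def tau_full_def
    by (simp, intro Ck_on_diff z Ck_on_sum Ck_on_mult Ck_on_const ri S)
  have R: "(\<Sum>k\<in>UNIV. r x $ k) \<noteq> 0" if "x \<in> S" for x
    using pos[OF that] by (metis sum_pos finite UNIV_not_empty less_irrefl)
  have q: "Ck_on k S (\<lambda>x. Qinv (r x) $ i $ j)" for i j
    unfolding Qinv_def
    by (simp, intro Ck_on_diff z Ck_on_divide Ck_on_sum Ck_on_mult ri S R)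
  have m: "Ck_on k S (\<lambda>x. matrix_inv (tau b (r x)) $ i $ j)" for i j
    using pos by (intro Ck_on_matrix_inv S t pos_def_invertible pos_def_tau_condition_N N) auto
  show ?thesis
    unfolding Dmat_def matrix_matrix_mult_def by (simp, intro Ck_on_sum Ck_on_mult q m S)
qed

section \<open>Gradient and divergence\<close>

lemma gradI:
  assumes "(f has_derivative f') (at x)"
  shows "grad f x = (\<chi> k. f' (axis k 1))"
  by (simp add: grad_def frechet_derivativeI[OF assms])

lemma has_derivative_grad:
  assumes "f differentiable (at x)"
  shows "(f has_derivative (\<lambda>h. grad f x \<bullet> h)) (at x)"
proof -
  have d: "(f has_derivative frechet_derivative f (at x)) (at x)"
    by (rule has_derivative_frechet[OF assms])
  have "frechet_derivative f (at x) h = grad f x \<bullet> h" for h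
  proof -
    have "frechet_derivative f (at x) h = frechet_derivative f (at x) (\<Sum>k\<in>UNIV. h $ k *\<^sub>R axis k 1)"
      by (simp add: basis_expansion[of h, unfolded scalar_mult_eq_scaleR])
    also have "\<dots> = (\<Sum>k\<in>UNIV. h $ k * frechet_derivative f (at x) (axis k 1))"
      using has_derivative_linear[OF d] by (simp add: linear_sum linear_cmul)
    finally show ?thesis by (simp add: grad_def inner_vec_def mult.commute)
  qed
  with d show ?thesis by (metis (no_types, lifting) ext)
qed

lemma grad_diff:
  assumes "f differentiable (at x)" "g differentiable (at x)"
  shows "grad (\<lambda>y. f y - g y) x = grad f x - grad g x"
  using gradI[OF has_derivative_diff[OF has_derivative_grad[OF assms(1)] has_derivative_grad[OF assms(2)]]]
  by (simp add: vec_eq_iff inner_axis)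

lemma grad_sum:
  assumes "\<And>i. i \<in> A \<Longrightarrow> f i differentiable (at x)"
  shows "grad (\<lambda>y. \<Sum>i\<in>A. f i y) x = (\<Sum>i\<in>A. grad (f i) x)"
  using gradI[OF has_derivative_sum[of A f, OF has_derivative_grad[OF assms]]]
  by (simp add: vec_eq_iff inner_axis)

lemma divergenceI:
  assumes "(w has_derivative w') (at x)"
  shows "divergence w x = (\<Sum>k\<in>UNIV. w' (axis k 1) $ k)"
  unfolding divergence_def
  using frechet_derivativeI[OF bounded_linear.has_derivative[OF bounded_linear_vec_nth assms]] by simp

lemma divergence_diff:
  assumes "v differentiable (at x)" "w differentiable (at x)"
  shows "divergence (\<lambda>y. v y - w y) x = divergence v x - divergence w x"
  using divergenceI[OF has_derivative_diff[OF assms[THEN has_derivative_frechet]]]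
    assms[THEN has_derivative_frechet, THEN divergenceI]
  by (simp add: sum_subtractf)

lemma divergence_sum:
  assumes "\<And>i. i \<in> A \<Longrightarrow> w i differentiable (at x)"
  shows "divergence (\<lambda>y. \<Sum>i\<in>A. w i y) x = (\<Sum>i\<in>A. divergence (w i) x)"
proof -
  have "divergence (\<lambda>y. \<Sum>i\<in>A. w i y) x
      = (\<Sum>k\<in>UNIV. \<Sum>i\<in>A. frechet_derivative (w i) (at x) (axis k 1) $ k)"
    using divergenceI[OF has_derivative_sum[of A w, OF has_derivative_frechet[OF assms]]]
    by simp
  also have "\<dots> = (\<Sum>i\<in>A. divergence (w i) x)"
    by (subst sum.swap) (simp add: divergenceI[OF has_derivative_frechet[OF assms]])
  finally show ?thesis .
qed

lemma divergence_scaleR: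
  assumes "f differentiable (at x)" "w differentiable (at x)"
  shows "divergence (\<lambda>y. f y *\<^sub>R w y) x = f x * divergence w x + grad f x \<bullet> w x"
  using divergenceI[OF has_derivative_scaleR[OF has_derivative_grad[OF assms(1)]
        has_derivative_frechet[OF assms(2)]]]
    divergenceI[OF has_derivative_frechet[OF assms(2)]]
  by (simp add: sum.distrib sum_distrib_left inner_axis inner_vec_def[of "grad f x" "w x"])

lemma divergence_cmult:
  assumes "w differentiable (at x)"
  shows "divergence (\<lambda>y. c *\<^sub>R w y) x = c * divergence w x"
  using divergenceI[OF has_derivative_scaleR_right[OF has_derivative_frechet[OF assms], of c]]
    divergenceI[OF has_derivative_frechet[OF assms]]
  by (simp add: sum_distrib_left)

lemma Ck_on_grad: "open S \<Longrightarrow> Ck_on (Suc k) S f \<Longrightarrow> Ck_on k S (grad f)"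
  unfolding grad_def[abs_def] by (intro Ck_on_vec_lambda Ck_on_derivative)

lemma Ck_on_divergence: "open S \<Longrightarrow> Ck_on (Suc k) S w \<Longrightarrow> Ck_on k S (divergence w)"
  unfolding divergence_def[abs_def] by (intro Ck_on_sum Ck_on_derivative Ck_on_vec_nth)

lemma Ck_on_grads: "open S \<Longrightarrow> Ck_on (Suc k) S r \<Longrightarrow> Ck_on k S (grads r)"
  unfolding grads_def[abs_def] by (intro Ck_on_vec_lambda Ck_on_grad Ck_on_vec_nth)

section \<open>Elimination of the last species\<close>

lemma completion_nth [simp]:
  "completion c s $ Some j = s $ j" "completion c s $ None = c - (\<Sum>j\<in>UNIV. s $ j)"
  by (simp_all add: completion_def)

lemma linear_completion: "linear (completion 0 :: 'a::real_vector^('m::finite) \<Rightarrow> 'a^('m option))"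
proof (rule linearI)
  fix x y :: "'a^'m"
  show "completion 0 (x + y) = completion 0 x + completion 0 y"
  proof (rule iffD2[OF vec_eq_iff], rule)
    fix i show "completion 0 (x + y) $ i = (completion 0 x + completion 0 y) $ i"
      by (cases i) (simp_all add: sum.distrib)
  qed
next
  fix c and x :: "'a^'m"
  show "completion 0 (c *\<^sub>R x) = c *\<^sub>R completion 0 x"
  proof (rule iffD2[OF vec_eq_iff], rule)
    fix i show "completion 0 (c *\<^sub>R x) $ i = (c *\<^sub>R completion 0 x) $ i"
      by (cases i) (simp_all add: scaleR_sum_right)
  qed
qed

lemma has_derivative_completion:
  fixes s :: "'a::euclidean_space^('m::finite)"
  shows "(completion c has_derivative completion 0) (at s)"
proof -
  have split: "completion c = (\<lambda>s::'a^'m. completion c 0 + completion 0 s)"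
  proof
    fix s :: "'a^'m"
    show "completion c s = completion c 0 + completion 0 s"
    proof (rule iffD2[OF vec_eq_iff], rule)
      fix i show "completion c s $ i = (completion c 0 + completion 0 s) $ i"
        by (cases i) simp_all
    qed
  qed
  have "bounded_linear (completion 0 :: 'a^'m \<Rightarrow> 'a^('m option))"
    by (simp add: linear_completion linear_conv_bounded_linear[symmetric])
  then have "(completion 0 has_derivative completion 0) (at s)"
    by (rule bounded_linear_imp_has_derivative)
  from has_derivative_add[OF has_derivative_const this, of "completion c 0"] show ?thesis
    by (subst split) simp
qed

lemma completed_profile_inverse:
  "completed_profile (total_density r) (reduced_profile r) = r"
proof
  fix x
  show "completed_profile (total_density r) (reduced_profile r) x = r x"
  proof (rule iffD2[OF vec_eq_iff], rule)
    fix i show "completed_profile (total_density r) (reduced_profile r) x $ i = r x $ i"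
      by (cases i) (simp_all add: completed_profile_def total_density_def reduced_profile_def sum_option)
  qed
qed

lemma total_density_completed: "total_density (completed_profile R s) = R"
  by (simp add: fun_eq_iff total_density_def completed_profile_def sum_option)

lemma reduced_profile_completed: "reduced_profile (completed_profile R s) = s"
  by (simp add: fun_eq_iff vec_eq_iff reduced_profile_def completed_profile_def)

lemma completion_grads:
  assumes "r differentiable (at x)"
  shows "completion (grad (total_density r) x) (grads (reduced_profile r) x) = grads r x"
proof (rule iffD2[OF vec_eq_iff], rule)
  fix i
  have d: "(\<lambda>y. r y $ i) differentiable (at x)" for i
    using assms by (rule differentiable_compose[OF bounded_linear_imp_differentiable
          [OF bounded_linear_vec_nth]])
  show "completion (grad (total_density r) x) (grads (reduced_profile r) x) $ i = grads r x $ i"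
    using grad_sum[of UNIV "\<lambda>i y. r y $ i" x, OF d]
    by (cases i) (simp_all add: grads_def reduced_profile_def total_density_def[abs_def] sum_option)
qed

section \<open>Variational derivatives\<close>

definition integrand_C4 :: "('k \<Rightarrow> real \<Rightarrow> real^3 \<Rightarrow> real) \<Rightarrow> bool" where
  "integrand_C4 F \<longleftrightarrow> (\<forall>i. Ck_on 4 ({0<..} \<times> UNIV) (\<lambda>(a, q). F i a q))"

definition profile_C4 :: "(real^3 \<Rightarrow> real^('k::finite)) \<Rightarrow> bool" where
  "profile_C4 r \<longleftrightarrow> Ck_on 4 UNIV r \<and> (\<forall>x i. 0 < r x $ i)"

text \<open>The partial derivatives of the integrand are read off from the derivative on the product space,
  to which the regularity hypothesis refers; \<open>integrand_has_derivative\<close> justifies this.\<close>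

definition dF_da :: "('k \<Rightarrow> real \<Rightarrow> real^3 \<Rightarrow> real) \<Rightarrow> 'k \<Rightarrow> real \<times> (real^3) \<Rightarrow> real" where
  "dF_da F i p = frechet_derivative (\<lambda>(a, q). F i a q) (at p) (1, 0)"

definition grad_q :: "('k \<Rightarrow> real \<Rightarrow> real^3 \<Rightarrow> real) \<Rightarrow> 'k \<Rightarrow> real \<times> (real^3) \<Rightarrow> real^3" where
  "grad_q F i p = (\<chi> k. frechet_derivative (\<lambda>(a, q). F i a q) (at p) (0, axis k 1))"

lemma open_half_space: "open ({0<..} \<times> UNIV :: (real \<times> (real^3)) set)"
  by (intro open_Times) auto

lemma Ck_on_dF_da: "integrand_C4 F \<Longrightarrow> Ck_on 3 ({0<..} \<times> UNIV) (dF_da F i)"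
  unfolding dF_da_def[abs_def] integrand_C4_def by (intro Ck_on_derivative) (simp add: eval_nat_numeral)

lemma Ck_on_grad_q: "integrand_C4 F \<Longrightarrow> Ck_on 3 ({0<..} \<times> UNIV) (grad_q F i)"
  unfolding grad_q_def[abs_def] integrand_C4_def
  by (intro Ck_on_vec_lambda open_half_space Ck_on_derivative) (simp add: eval_nat_numeral)

lemma integrand_has_derivative:
  assumes F: "integrand_C4 F" and "0 < fst p"
  shows "((\<lambda>(a, q). F i a q) has_derivative (\<lambda>h. dF_da F i p * fst h + grad_q F i p \<bullet> snd h)) (at p)"
proof -
  let ?D = "frechet_derivative (\<lambda>(a, q). F i a q) (at p)"
  have "p \<in> {0<..} \<times> UNIV" using assms(2) by (cases p) auto
  moreover have "Ck_on 4 ({0<..} \<times> UNIV) (\<lambda>(a, q). F i a q)" using F by (simp add: integrand_C4_def)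
  ultimately have d: "((\<lambda>(a, q). F i a q) has_derivative ?D) (at p)"
    by (intro has_derivative_frechet Ck_on_differentiable[of 4]) auto
  note lin = has_derivative_linear[OF d]
  have "?D h = dF_da F i p * fst h + grad_q F i p \<bullet> snd h" for h
  proof -
    have "h = fst h *\<^sub>R (1, 0) + (\<Sum>k\<in>UNIV. snd h $ k *\<^sub>R (0, axis k 1))"
      using basis_expansion[of "snd h"]
      by (simp add: prod_eq_iff fst_sum snd_sum scalar_mult_eq_scaleR)
    then have "?D h = ?D (fst h *\<^sub>R (1, 0) + (\<Sum>k\<in>UNIV. snd h $ k *\<^sub>R (0, axis k 1)))"
      by simp
    also have "\<dots> = fst h * ?D (1, 0) + (\<Sum>k\<in>UNIV. snd h $ k * ?D (0, axis k 1))"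
      by (simp only: linear_add[OF lin] linear_sum[OF lin] linear_cmul[OF lin] real_scaleR_def)
    finally show ?thesis
      by (simp add: dF_da_def grad_q_def inner_vec_def mult.commute)
  qed
  then have "?D = (\<lambda>h. dF_da F i p * fst h + grad_q F i p \<bullet> snd h)" by (rule ext)
  with d show ?thesis by simp
qed

text \<open>Every derivative of the energy density below is an instance of this chain rule: along a
  curve in time, and along affine families of densities or of gradients.\<close>

lemma energy_density_has_derivative:
  fixes F :: "'k::finite \<Rightarrow> real \<Rightarrow> real^3 \<Rightarrow> real"
  assumes F: "integrand_C4 F" and pos: "\<And>i. 0 < r z $ i"
    and r: "(r has_derivative r') (at z)" and q: "(q has_derivative q') (at z)"
  shows "((\<lambda>z. energy_density F (r z) (q z)) has_derivative
    (\<lambda>h. \<Sum>i\<in>UNIV. dF_da F i (r z $ i, q z $ i) * r' h $ i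
       + grad_q F i (r z $ i, q z $ i) \<bullet> q' h $ i)) (at z)"
  unfolding energy_density_def
proof (rule has_derivative_sum)
  fix i
  have "((\<lambda>z. (r z $ i, q z $ i)) has_derivative (\<lambda>h. (r' h $ i, q' h $ i))) (at z)"
    by (intro has_derivative_Pair bounded_linear.has_derivative[OF bounded_linear_vec_nth] r q)
  from has_derivative_compose[OF this integrand_has_derivative[OF F, of "(r z $ i, q z $ i)" i]]
  show "((\<lambda>z. F i (r z $ i) (q z $ i)) has_derivative
    (\<lambda>h. dF_da F i (r z $ i, q z $ i) * r' h $ i + grad_q F i (r z $ i, q z $ i) \<bullet> q' h $ i)) (at z)"
    using pos by simp
qed

lemma
  assumes "profile_C4 r"
  shows Ck_on_profile: "Ck_on 4 UNIV r" and profile_pos: "0 < r x $ i"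
  using assms by (auto simp: profile_C4_def)

lemma profile_differentiable: "profile_C4 r \<Longrightarrow> r differentiable (at x)"
  by (rule Ck_on_differentiable[OF Ck_on_profile]) auto

lemma Ck_on_grads_profile: "profile_C4 r \<Longrightarrow> Ck_on 3 UNIV (grads r)"
  by (intro Ck_on_grads) (simp_all add: profile_C4_def eval_nat_numeral)

lemma Ck_on_state: "profile_C4 r \<Longrightarrow> Ck_on 3 UNIV (\<lambda>x. (r x $ i, grads r x $ i))"
  by (intro Ck_on_Pair Ck_on_vec_nth open_UNIV Ck_on_grads_profile
      Ck_on_mono[OF Ck_on_profile]) simp_all

context
  fixes F :: "'k::finite \<Rightarrow> real \<Rightarrow> real^3 \<Rightarrow> real" and r :: "real^3 \<Rightarrow> real^'k"
  assumes F: "integrand_C4 F" and r: "profile_C4 r"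
begin

lemma dF_dq_eq: "dF_dq F r i x = grad_q F i (r x $ i, grads r x $ i)"
proof -
  have "((\<lambda>q. (r x $ i, q)) has_derivative (\<lambda>h. (0, h))) (at (grads r x $ i))"
    by (auto intro!: derivative_eq_intros)
  from has_derivative_compose[OF this integrand_has_derivative[OF F, of "(r x $ i, grads r x $ i)" i]]
  have "((\<lambda>q. F i (r x $ i) q) has_derivative (\<lambda>h. grad_q F i (r x $ i, grads r x $ i) \<bullet> h))
      (at (grads r x $ i))"
    using profile_pos[OF r] by simp
  from gradI[OF this] show ?thesis by (simp add: dF_dq_def vec_eq_iff inner_axis)
qed

lemma Ck_on_dF_dq: "Ck_on 3 UNIV (dF_dq F r i)"
  unfolding dF_dq_eq[abs_def]
  by (rule Ck_on_compose[OF open_UNIV Ck_on_state[OF r] Ck_on_grad_q[OF F]]) (simp add: profile_pos[OF r])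

lemma var_deriv_eq:
  "var_deriv F r i x = dF_da F i (r x $ i, grads r x $ i) - divergence (dF_dq F r i) x"
proof -
  have "((\<lambda>a. (a, grads r x $ i)) has_derivative (\<lambda>h. (h, 0))) (at (r x $ i))"
    by (auto intro!: derivative_eq_intros)
  from has_derivative_compose[OF this integrand_has_derivative[OF F, of "(r x $ i, grads r x $ i)" i]]
  have "((\<lambda>a. F i a (grads r x $ i)) has_real_derivative dF_da F i (r x $ i, grads r x $ i))
      (at (r x $ i))"
    using profile_pos[OF r]
    by (simp add: has_field_derivative_def mult_commute_abs)
  then show ?thesis by (simp add: var_deriv_def DERIV_imp_deriv)
qed

lemma Ck_on_var_deriv: "Ck_on 2 UNIV (var_deriv F r i)"
  unfolding var_deriv_eq[abs_def]
proof (intro Ck_on_diff Ck_on_divergence open_UNIV)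
  have "Ck_on 3 UNIV (\<lambda>x. dF_da F i (r x $ i, grads r x $ i))"
    by (rule Ck_on_compose[OF open_UNIV Ck_on_state[OF r] Ck_on_dF_da[OF F]]) (simp add: profile_pos[OF r])
  then show "Ck_on 2 UNIV (\<lambda>x. dF_da F i (r x $ i, grads r x $ i))"
    by (rule Ck_on_mono) simp
  show "Ck_on (Suc 2) UNIV (dF_dq F r i)"
    using Ck_on_dF_dq by (simp add: eval_nat_numeral)
qed

end

text \<open>Derivatives of the reduced density in the direction of a species \<open>j\<close> are taken along
  \<open>completion 0 (axis j 1)\<close>, the exchange of species \<open>j\<close> against the eliminated one.\<close>

lemma sum_completion_axis:
  fixes f :: "'m::finite option \<Rightarrow> 'a::real_inner" and a :: 'a
  shows "(\<Sum>i\<in>UNIV. f i \<bullet> completion 0 (axis j a) $ i) = f (Some j) \<bullet> a - f None \<bullet> a"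
proof -
  have "(\<Sum>i\<in>UNIV. (axis j a :: 'a^'m) $ i) = a"
    by (simp add: axis_def)
  moreover have "(\<Sum>i\<in>UNIV. f (Some i) \<bullet> (axis j a :: 'a^'m) $ i) = f (Some j) \<bullet> a"
    by (simp add: axis_def if_distrib cong: if_cong)
  ultimately show ?thesis by (simp add: sum_option)
qed

lemma red_var_deriv_eq:
  fixes F :: "'m::finite option \<Rightarrow> real \<Rightarrow> real^3 \<Rightarrow> real"
  assumes F: "integrand_C4 F" and r: "profile_C4 r"
  shows "red_var_deriv F (total_density r) (reduced_profile r) j x =
    var_deriv F r (Some j) x - var_deriv F r None x"
proof -
  let ?R = "total_density r" and ?s = "reduced_profile r"
  have c: "completion (?R y) (?s y) = r y" for y
    using completed_profile_inverse[of r] by (metis completed_profile_def)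
  have cg: "completion (grad ?R y) (grads ?s y) = grads r y" for y
    by (rule completion_grads[OF profile_differentiable[OF r]])
  note pos = profile_pos[OF r]
  have "((\<lambda>a. red_density F ?R x a (grads ?s x)) has_derivative
      (\<lambda>h. \<Sum>i\<in>UNIV. dF_da F i (r x $ i, grads r x $ i) * completion 0 h $ i)) (at (?s x))"
    using energy_density_has_derivative[OF F _ has_derivative_completion has_derivative_const,
        of "?R x" "?s x" "grads r x"] pos
    by (simp add: red_density_def c cg)
  from frechet_derivativeI[OF this]
  have 1: "frechet_derivative (\<lambda>a. red_density F ?R x a (grads ?s x)) (at (?s x)) (axis j 1) =
      dF_da F (Some j) (r x $ Some j, grads r x $ Some j) - dF_da F None (r x $ None, grads r x $ None)"
    using sum_completion_axis[of "\<lambda>i. dF_da F i (r x $ i, grads r x $ i)" j 1] by simp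
  have "(\<chi> k. frechet_derivative (red_density F ?R y (?s y)) (at (grads ?s y)) (axis j (axis k 1)))
      = dF_dq F r (Some j) y - dF_dq F r None y" for y
  proof -
    have "(red_density F ?R y (?s y) has_derivative
        (\<lambda>h. \<Sum>i\<in>UNIV. grad_q F i (r y $ i, grads r y $ i) \<bullet> completion 0 h $ i)) (at (grads ?s y))"
      using energy_density_has_derivative[OF F _ has_derivative_const has_derivative_completion,
          of "r y" "grad ?R y" "grads ?s y"] pos
      by (simp add: red_density_def[abs_def] c cg)
    from frechet_derivativeI[OF this] show ?thesis
      using sum_completion_axis[of "\<lambda>i. grad_q F i (r y $ i, grads r y $ i)" j]
      by (simp add: dF_dq_eq[OF F r] vec_eq_iff inner_axis)
  qed
  then have "divergence (\<lambda>y. \<chi> k. frechet_derivative (red_density F ?R y (?s y)) (at (grads ?s y))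
      (axis j (axis k 1))) x = divergence (dF_dq F r (Some j)) x - divergence (dF_dq F r None) x"
    using divergence_diff[of "dF_dq F r (Some j)" x "dF_dq F r None"]
      Ck_on_differentiable[OF Ck_on_dF_dq[OF F r]] by simp
  with 1 show ?thesis
    by (simp add: red_var_deriv_def euler_lagrange_def var_deriv_eq[OF F r])
qed

lemma Ck_on_red_var_deriv:
  fixes F :: "'m::finite option \<Rightarrow> real \<Rightarrow> real^3 \<Rightarrow> real"
  assumes F: "integrand_C4 F" and r: "profile_C4 r"
  shows "Ck_on 2 UNIV (red_var_deriv F (total_density r) (reduced_profile r) j)"
  unfolding red_var_deriv_eq[OF assms, abs_def]
  by (intro Ck_on_diff Ck_on_var_deriv assms open_UNIV)

lemma Ck_on_red_flux:
  fixes F :: "'m::finite option \<Rightarrow> real \<Rightarrow> real^3 \<Rightarrow> real"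
  assumes F: "integrand_C4 F" and r: "profile_C4 r" and N: "condition_N b"
  shows "Ck_on 1 UNIV (red_flux b F (total_density r) (reduced_profile r) i)"
  unfolding red_flux_def[abs_def] completed_profile_inverse
proof (intro Ck_on_sum Ck_on_scaleR Ck_on_grad Ck_on_Dmat N open_UNIV)
  show "Ck_on 1 UNIV r" by (rule Ck_on_mono[OF Ck_on_profile[OF r]]) simp
  show "Ck_on (Suc 1) UNIV (red_var_deriv F (total_density r) (reduced_profile r) j)" for j
    using Ck_on_red_var_deriv[OF F r] by (simp add: eval_nat_numeral)
qed (rule profile_pos[OF r])

lemma maxwell_stefan_flux:
  fixes F :: "'m::finite option \<Rightarrow> real \<Rightarrow> real^3 \<Rightarrow> real"
  assumes F: "integrand_C4 F" and r: "profile_C4 r" and N: "condition_N b"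
    and ms: "maxwell_stefan \<epsilon> b F r u"
  shows "r x $ Some i *\<^sub>R u x $ Some i =
    - \<epsilon> *\<^sub>R red_flux b F (total_density r) (reduced_profile r) i x"
proof (rule iffD2[OF vec_eq_iff], rule)
  fix k
  let ?u = "\<chi> i. u x $ i $ k" and ?g = "\<chi> i. grad (var_deriv F r i) x $ k"
  have gr: "grad (red_var_deriv F (total_density r) (reduced_profile r) j) x =
      grad (var_deriv F r (Some j)) x - grad (var_deriv F r None) x" for j
    unfolding red_var_deriv_eq[OF F r, abs_def]
    by (intro grad_diff Ck_on_differentiable[OF Ck_on_var_deriv[OF F r]]) auto
  have "r x $ Some i * ?u $ Some i
      = - \<epsilon> * (\<Sum>j\<in>UNIV. Dmat b (r x) $ i $ j * (?g $ Some j - ?g $ None))"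
  proof (rule maxwell_stefan_inversion[OF N profile_pos[OF r]])
    fix i
    have "- (\<Sum>j\<in>UNIV. (b $ i $ j * r x $ i * r x $ j) *\<^sub>R (u x $ i - u x $ j))
        = \<epsilon> *\<^sub>R driving_force F r i x"
      using ms by (simp add: maxwell_stefan_def)
    from arg_cong[OF this, of "\<lambda>v. v $ k"] show "- (\<Sum>j\<in>UNIV. b $ i $ j * r x $ i * r x $ j * (?u $ i - ?u $ j)) =
      \<epsilon> * (r x $ i * ?g $ i - r x $ i / (\<Sum>k\<in>UNIV. r x $ k) * (\<Sum>j\<in>UNIV. r x $ j * ?g $ j))"
      by (simp add: driving_force_def total_density_def)
  next
    have "(\<Sum>j\<in>UNIV. r x $ j *\<^sub>R u x $ j) = 0" using ms by (simp add: maxwell_stefan_def)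
    from arg_cong[OF this, of "\<lambda>v. v $ k"]
    show "(\<Sum>j\<in>UNIV. r x $ j * ?u $ j) = 0" by simp
  qed
  then show "(r x $ Some i *\<^sub>R u x $ Some i) $ k =
      (- \<epsilon> *\<^sub>R red_flux b F (total_density r) (reduced_profile r) i x) $ k"
    by (simp add: red_flux_def completed_profile_inverse gr)
qed

section \<open>The reduced Hessian\<close>

text \<open>A matrix of second derivatives is known through the derivative \<open>A j\<close> of the \<open>j\<close>-th partial
  derivative; its bilinear form is evaluated without expanding the first vector into coordinates.\<close>

lemma bilinear_from_columns:
  fixes H :: "real^'k^('k::finite)"
  assumes "\<And>j. linear (A j)" and "\<And>i j. H $ i $ j = A j (axis i 1)"
  shows "y \<bullet> (H *v z) = (\<Sum>j\<in>UNIV. A j y * z $ j)"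
proof -
  have "A j y = (\<Sum>i\<in>UNIV. y $ i * H $ i $ j)" for j
  proof -
    have "A j y = A j (\<Sum>i\<in>UNIV. y $ i *\<^sub>R axis i 1)"
      by (simp add: basis_expansion[of y, unfolded scalar_mult_eq_scaleR])
    also have "\<dots> = (\<Sum>i\<in>UNIV. y $ i * A j (axis i 1))"
      by (simp add: linear_sum[OF assms(1)] linear_cmul[OF assms(1)])
    finally show ?thesis by (simp add: assms(2))
  qed
  then have "(\<Sum>j\<in>UNIV. A j y * z $ j) = (\<Sum>j\<in>UNIV. \<Sum>i\<in>UNIV. y $ i * H $ i $ j * z $ j)"
    by (simp add: sum_distrib_right)
  also have "\<dots> = (\<Sum>i\<in>UNIV. \<Sum>j\<in>UNIV. y $ i * H $ i $ j * z $ j)"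
    by (rule sum.swap)
  finally show ?thesis
    by (simp add: inner_vec_def matrix_vector_mult_def sum_distrib_left mult.assoc)
qed

text \<open>\<open>completion 0\<close> maps onto the vectors with sum zero, the directions in which the densities vary
  at fixed total density. The identity follows by differentiating the energy density twice
  along the affine map \<open>completion c\<close>, whose derivative is \<open>completion 0\<close>.\<close>

lemma red_energy_hessian_form:
  fixes F :: "'m::finite option \<Rightarrow> real \<Rightarrow> real^3 \<Rightarrow> real"
  assumes F: "integrand_C4 F" and r: "profile_C4 r"
  shows "y \<bullet> (red_energy_hessian F (total_density r) (reduced_profile r) x *v z) =
    completion 0 y \<bullet> (energy_hessian F r x *v completion 0 z)"
proof -
  let ?R = "total_density r" and ?s = "reduced_profile r"
  have c: "completion (?R x) (?s x) = r x"
    using completed_profile_inverse[of r] by (metis completed_profile_def)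
  have cg: "completion (grad ?R x) (grads ?s x) = grads r x"
    by (rule completion_grads[OF profile_differentiable[OF r]])
  let ?q = "grads r x"
  let ?\<phi> = "\<lambda>i a. dF_da F i (a $ i, ?q $ i)"
  let ?A = "\<lambda>i. frechet_derivative (?\<phi> i) (at (r x))"
  have \<phi>: "(?\<phi> i has_derivative ?A i) (at (r x))" for i
  proof (rule has_derivative_frechet)
    have "open {a. 0 < (a::real^('m option)) $ i}" by (intro open_Collect_less continuous_intros)
    moreover have "Ck_on 3 {a. 0 < (a::real^('m option)) $ i} (?\<phi> i)"
      by (rule Ck_on_compose[OF calculation _ Ck_on_dF_da[OF F]])
        (auto intro!: Ck_on_Pair Ck_on_vec_nth Ck_on_ident Ck_on_const calculation)
    ultimately show "?\<phi> i differentiable (at (r x))"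
      using Ck_on_differentiable profile_pos[OF r] by fastforce
  qed
  have lin: "linear (?A i)" for i by (rule has_derivative_linear[OF \<phi>])
  let ?U = "{a. \<forall>i. 0 < (a::real^('m option)) $ i}"
  have U: "open ?U"
    unfolding Collect_all_eq by (intro open_INT ballI open_Collect_less continuous_intros finite)
  have first: "frechet_derivative (\<lambda>a. energy_density F a ?q) (at a) h = (\<Sum>i\<in>UNIV. ?\<phi> i a * h $ i)"
    if "a \<in> ?U" for a h
    using frechet_derivativeI[OF energy_density_has_derivative[OF F _ has_derivative_ident
          has_derivative_const, of a ?q]] that by simp
  have "energy_hessian F r x $ i $ j = ?A j (axis i 1)" for i j
  proof -
    have "frechet_derivative (\<lambda>a. energy_density F a ?q) (at a) (axis j 1) = ?\<phi> j a" if "a \<in> ?U" for a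
      unfolding first[OF that] by (simp add: axis_def if_distrib cong: if_cong)
    then have "((\<lambda>a. frechet_derivative (\<lambda>a. energy_density F a ?q) (at a) (axis j 1))
        has_derivative ?A j) (at (r x))"
      using profile_pos[OF r]
      by (intro has_derivative_transform_within_open[OF \<phi> U]) auto
    then show ?thesis
      by (simp add: energy_hessian_def hessian_def frechet_derivativeI)
  qed
  then have full: "y \<bullet> (energy_hessian F r x *v z) = (\<Sum>j\<in>UNIV. ?A j y * z $ j)" for y z
    by (rule bilinear_from_columns[OF lin])
  let ?C = "completion (?R x)"
  let ?V = "?C -` ?U"
  have V: "open ?V"
    using has_derivative_completion U
    by (intro open_vimage continuous_at_imp_continuous_on) (auto intro: has_derivative_continuous)
  let ?B = "\<lambda>j h. ?A (Some j) (completion 0 h) - ?A None (completion 0 h)"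
  have "red_energy_hessian F ?R ?s x $ i $ j = ?B j (axis i 1)" for i j
  proof -
    have red: "frechet_derivative (\<lambda>a. energy_density F (?C a) ?q) (at a) (axis j 1)
        = ?\<phi> (Some j) (?C a) - ?\<phi> None (?C a)" if "a \<in> ?V" for a
    proof -
      have "((\<lambda>a. energy_density F (?C a) ?q) has_derivative
          (\<lambda>h. \<Sum>i\<in>UNIV. ?\<phi> i (?C a) * completion 0 h $ i)) (at a)"
        using energy_density_has_derivative[OF F _ has_derivative_completion has_derivative_const,
            of "?R x" a ?q] that by simp
      from frechet_derivativeI[OF this] show ?thesis
        using sum_completion_axis[of "\<lambda>i. ?\<phi> i (?C a)" j 1] by simp
    qed
    have "((\<lambda>a. ?\<phi> i (?C a)) has_derivative (\<lambda>h. ?A i (completion 0 h))) (at (?s x))" for i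
      using \<phi>[of i] by (intro has_derivative_compose[OF has_derivative_completion]) (simp add: c)
    from has_derivative_diff[OF this this]
    have d: "((\<lambda>a. ?\<phi> (Some j) (?C a) - ?\<phi> None (?C a)) has_derivative ?B j) (at (?s x))" .
    have "((\<lambda>a. frechet_derivative (\<lambda>a. energy_density F (?C a) ?q) (at a) (axis j 1))
        has_derivative ?B j) (at (?s x))"
    proof (rule has_derivative_transform_within_open[OF d V])
      show "?s x \<in> ?V" by (simp add: c profile_pos[OF r])
    qed (rule red[symmetric])
    then show ?thesis
      by (simp add: red_energy_hessian_def hessian_def red_density_def cg frechet_derivativeI)
  qed
  moreover have "linear (?B j)" for j
    using linear_compose[OF linear_completion lin] by (intro linear_compose_sub) (auto simp: o_def)
  ultimately have "y \<bullet> (red_energy_hessian F ?R ?s x *v z) = (\<Sum>j\<in>UNIV. ?B j y * z $ j)"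
    using bilinear_from_columns[of ?B] by blast
  also have "\<dots> = (\<Sum>j\<in>UNIV. ?A j (completion 0 y) * completion 0 z $ j)"
    by (simp add: sum_option left_diff_distrib sum_subtractf sum_distrib_left)
  finally show ?thesis unfolding full .
qed

lemma pos_def_red_energy_hessian:
  fixes F :: "'m::finite option \<Rightarrow> real \<Rightarrow> real^3 \<Rightarrow> real"
  assumes F: "integrand_C4 F" and r: "profile_C4 r" and H: "pos_def (energy_hessian F r x)"
  shows "pos_def (red_energy_hessian F (total_density r) (reduced_profile r) x)"
    (is "pos_def ?H")
proof (rule pos_defI)
  have entry: "?H $ i $ j = axis i 1 \<bullet> (?H *v axis j 1)" for i j
    by (simp add: inner_axis' matrix_vector_mult_basis column_def)
  have sym: "?H $ j $ i = ?H $ i $ j" for i j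
    unfolding entry red_energy_hessian_form[OF F r] by (rule pos_def_swap[OF H])
  show "transpose ?H = ?H" unfolding vec_eq_iff transpose_def by (simp add: sym)
  fix z :: "real^'m" assume "z \<noteq> 0"
  then obtain j where "z $ j \<noteq> 0" by (auto simp: vec_eq_iff)
  then have "completion 0 z $ Some j \<noteq> 0" by simp
  then have "completion 0 z \<noteq> 0" by (auto simp del: completion_nth)
  from pos_def_pos[OF H this] show "0 < z \<bullet> (?H *v z)"
    by (simp add: red_energy_hessian_form[OF F r])
qed

section \<open>Dependence on time\<close>

lemma has_derivative_vec:
  fixes f :: "'a::real_normed_vector \<Rightarrow> 'b::real_normed_vector^('n::finite)"
  assumes "\<And>i. ((\<lambda>x. f x $ i) has_derivative (\<lambda>h. f' h $ i)) F"
  shows "(f has_derivative f') F"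
proof -
  have "(\<Sum>i\<in>UNIV. axis i (v $ i)) = v" for v :: "'b^'n"
    by (simp add: vec_eq_iff axis_def if_distrib cong: if_cong)
  moreover have "((\<lambda>x. \<Sum>i\<in>UNIV. axis i (f x $ i)) has_derivative
      (\<lambda>h. \<Sum>i\<in>UNIV. axis i (f' h $ i))) F"
    by (intro has_derivative_sum bounded_linear.has_derivative[OF bounded_linear_axis] assms)
  ultimately show ?thesis by simp
qed

lemma Ck_on_time_slice:
  fixes G :: "real \<times> (real^3) \<Rightarrow> 'b::real_normed_vector"
  assumes "Ck_on k (I \<times> UNIV) G" and "t \<in> I"
  shows "Ck_on k UNIV (\<lambda>x. G (t, x))"
proof (rule Ck_on_compose[OF open_UNIV _ assms(1)])
  show "Ck_on k UNIV (Pair t :: real^3 \<Rightarrow> _)"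
    by (rule Ck_on_Pair[OF open_UNIV Ck_on_const Ck_on_ident]) simp_all
qed (use assms(2) in simp)

lemma partial_derivatives:
  fixes G :: "real \<times> (real^3) \<Rightarrow> real"
  assumes G: "Ck_on (Suc k) (I \<times> UNIV) G" and t: "t \<in> I"
  shows "((\<lambda>s. G (s, x)) has_real_derivative frechet_derivative G (at (t, x)) (1, 0)) (at t)"
    and "grad (\<lambda>y. G (t, y)) x = (\<chi> l. frechet_derivative G (at (t, x)) (0, axis l 1))"
proof -
  have d: "(G has_derivative frechet_derivative G (at (t, x))) (at (t, x))"
    using t by (intro Ck_on_has_derivative[OF G]) auto
  show "((\<lambda>s. G (s, x)) has_real_derivative frechet_derivative G (at (t, x)) (1, 0)) (at t)"
    using Ck_on_line_derivative[OF G, of "(0, x)" t "(1, 0)"] t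
    by (simp add: has_real_derivative_iff_has_vector_derivative)
  have "((\<lambda>y. (t, y)) has_derivative (\<lambda>h. (0, h))) (at x)"
    by (auto intro!: derivative_eq_intros)
  from gradI[OF has_derivative_compose[OF this d]]
  show "grad (\<lambda>y. G (t, y)) x = (\<chi> l. frechet_derivative G (at (t, x)) (0, axis l 1))" .
qed

lemma profile_C4_state:
  assumes "positive_state I \<sigma>" and "smooth_state I \<sigma>" and "t \<in> I"
  shows "profile_C4 (\<sigma> t)"
proof -
  have "Ck_on 4 UNIV (\<sigma> t)"
    using Ck_on_time_slice[OF assms(2)[unfolded smooth_state_def] assms(3)] by simp
  then show ?thesis using assms by (simp add: profile_C4_def positive_state_def)
qed

context
  fixes I :: "real set" and \<sigma> :: "real \<Rightarrow> real^3 \<Rightarrow> real^('k::finite)"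
  assumes I: "open I" and smooth: "smooth_state I \<sigma>"
begin

lemma open_time_space: "open (I \<times> UNIV :: (real \<times> (real^3)) set)"
  by (intro open_Times I open_UNIV)

lemma Ck_on_species: "Ck_on 4 (I \<times> UNIV) (\<lambda>(t, x). \<sigma> t x $ i)"
  using Ck_on_vec_nth[OF open_time_space smooth[unfolded smooth_state_def], of i]
  by (simp add: case_prod_beta')

lemma time_derivative:
  assumes "t \<in> I"
  shows "deriv (\<lambda>s. \<sigma> s x $ i) t = frechet_derivative (\<lambda>(t, x). \<sigma> t x $ i) (at (t, x)) (1, 0)"
    and "((\<lambda>s. \<sigma> s x $ i) has_real_derivative deriv (\<lambda>s. \<sigma> s x $ i) t) (at t)"
proof -
  have "((\<lambda>s. \<sigma> s x $ i) has_real_derivative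
      frechet_derivative (\<lambda>(t, x). \<sigma> t x $ i) (at (t, x)) (1, 0)) (at t)"
    using partial_derivatives(1)[OF Ck_on_mono[OF Ck_on_species, of "Suc 3"] assms, of i x] by simp
  then show "deriv (\<lambda>s. \<sigma> s x $ i) t = frechet_derivative (\<lambda>(t, x). \<sigma> t x $ i) (at (t, x)) (1, 0)"
    "((\<lambda>s. \<sigma> s x $ i) has_real_derivative deriv (\<lambda>s. \<sigma> s x $ i) t) (at t)"
    by (simp_all add: DERIV_imp_deriv)
qed

lemma Ck_on_time_derivative:
  assumes "t \<in> I"
  shows "Ck_on 3 UNIV (\<lambda>x. deriv (\<lambda>s. \<sigma> s x $ i) t)"
proof -
  have "Ck_on 3 (I \<times> UNIV) (\<lambda>p. frechet_derivative (\<lambda>(t, x). \<sigma> t x $ i) (at p) (1, 0))"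
    by (intro Ck_on_derivative Ck_on_mono[OF Ck_on_species]) simp
  from Ck_on_time_slice[OF this assms] show ?thesis
    unfolding time_derivative(1)[OF assms] .
qed

text \<open>The mixed derivatives of a density, as a function of time and space together, commute.\<close>

lemma time_derivative_grads:
  assumes "t \<in> I"
  shows "((\<lambda>s. grads (\<sigma> s) x $ i) has_vector_derivative grad (\<lambda>y. deriv (\<lambda>s. \<sigma> s y $ i) t) x) (at t)"
  unfolding has_vector_derivative_def
proof (rule has_derivative_vec)
  fix l
  let ?S = "\<lambda>(t, x). \<sigma> t x $ i"
  let ?Dx = "\<lambda>p. frechet_derivative ?S (at p) (0, axis l 1)"
  let ?Dt = "\<lambda>p. frechet_derivative ?S (at p) (1, 0)"
  have S: "Ck_on (Suc 3) (I \<times> UNIV) ?S" "Ck_on 2 (I \<times> UNIV) ?S"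
    by (rule Ck_on_mono[OF Ck_on_species], simp)+
  have D: "Ck_on (Suc 2) (I \<times> UNIV) ?Dx" "Ck_on (Suc 2) (I \<times> UNIV) ?Dt"
    by (rule Ck_on_mono[OF Ck_on_derivative[OF S(1)]], simp)+
  have eq: "?Dx (s, x) = grads (\<sigma> s) x $ i $ l" if "s \<in> I" for s
    using partial_derivatives(2)[OF S(1) that, of x] by (simp add: grads_def)
  have "((\<lambda>s. ?Dx (s, x)) has_real_derivative frechet_derivative ?Dx (at (t, x)) (1, 0)) (at t)"
    by (rule partial_derivatives(1)[OF D(1) assms])
  moreover have "frechet_derivative ?Dx (at (t, x)) (1, 0) =
      frechet_derivative ?Dt (at (t, x)) (0, axis l 1)"
    using assms by (intro mixed_derivatives_commute[OF open_time_space S(2)]) auto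
  moreover have "\<dots> = grad (\<lambda>y. deriv (\<lambda>s. \<sigma> s y $ i) t) x $ l"
    using partial_derivatives(2)[OF D(2) assms, of x] by (simp add: time_derivative(1)[OF assms])
  ultimately have "((\<lambda>s. ?Dx (s, x)) has_derivative
      (\<lambda>h. (h *\<^sub>R grad (\<lambda>y. deriv (\<lambda>s. \<sigma> s y $ i) t) x) $ l)) (at t)"
    by (simp add: has_field_derivative_def mult_commute_abs)
  then show "((\<lambda>s. grads (\<sigma> s) x $ i $ l) has_derivative
      (\<lambda>h. (h *\<^sub>R grad (\<lambda>y. deriv (\<lambda>s. \<sigma> s y $ i) t) x) $ l)) (at t)"
    by (rule has_derivative_transform_within_open[OF _ I assms eq])
qed

text \<open>The part of the time derivative that acts on the gradients is
  integrated by parts, which leaves the variational derivatives and a divergence.\<close>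

lemma energy_density_time_derivative:
  fixes F :: "'k \<Rightarrow> real \<Rightarrow> real^3 \<Rightarrow> real"
  assumes F: "integrand_C4 F" and pos: "positive_state I \<sigma>" and t: "t \<in> I"
  shows "((\<lambda>s. energy_density F (\<sigma> s x) (grads (\<sigma> s) x)) has_real_derivative
    (\<Sum>i\<in>UNIV. deriv (\<lambda>s. \<sigma> s x $ i) t * var_deriv F (\<sigma> t) i x)
    + divergence (\<lambda>x. \<Sum>i\<in>UNIV. deriv (\<lambda>s. \<sigma> s x $ i) t *\<^sub>R dF_dq F (\<sigma> t) i x) x) (at t)"
proof -
  note r = profile_C4_state[OF pos smooth t]
  let ?w = "\<lambda>i x. deriv (\<lambda>s. \<sigma> s x $ i) t"
  let ?p = "\<lambda>i. (\<sigma> t x $ i, grads (\<sigma> t) x $ i)"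
  have \<sigma>: "((\<lambda>s. \<sigma> s x) has_derivative (\<lambda>h. \<chi> i. h * ?w i x)) (at t)"
    using time_derivative(2)[OF t]
    by (intro has_derivative_vec) (simp add: has_field_derivative_def mult_commute_abs)
  have g: "((\<lambda>s. grads (\<sigma> s) x) has_derivative (\<lambda>h. \<chi> i. h *\<^sub>R grad (?w i) x)) (at t)"
    using time_derivative_grads[OF t]
    by - (rule has_derivative_vec, simp add: has_vector_derivative_def)
  have w: "?w i differentiable (at x)" for i
    by (rule Ck_on_differentiable[OF Ck_on_time_derivative[OF t]]) auto
  have q: "dF_dq F (\<sigma> t) i differentiable (at x)" for i
    by (rule Ck_on_differentiable[OF Ck_on_dF_dq[OF F r]]) auto
  have "divergence (\<lambda>x. \<Sum>i\<in>UNIV. ?w i x *\<^sub>R dF_dq F (\<sigma> t) i x) x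
      = (\<Sum>i\<in>UNIV. ?w i x * divergence (dF_dq F (\<sigma> t) i) x + grad (?w i) x \<bullet> dF_dq F (\<sigma> t) i x)"
    using w q by (subst divergence_sum) (auto simp: divergence_scaleR intro: differentiable_scaleR)
  then have "(\<Sum>i\<in>UNIV. ?w i x * var_deriv F (\<sigma> t) i x)
      + divergence (\<lambda>x. \<Sum>i\<in>UNIV. ?w i x *\<^sub>R dF_dq F (\<sigma> t) i x) x
    = (\<Sum>i\<in>UNIV. dF_da F i (?p i) * ?w i x + grad_q F i (?p i) \<bullet> grad (?w i) x)"
    by (simp add: var_deriv_eq[OF F r] dF_dq_eq[OF F r] sum.distrib[symmetric] algebra_simps
        inner_commute)
  moreover have "((\<lambda>s. energy_density F (\<sigma> s x) (grads (\<sigma> s) x)) has_derivative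
      (\<lambda>h. h * (\<Sum>i\<in>UNIV. dF_da F i (?p i) * ?w i x + grad_q F i (?p i) \<bullet> grad (?w i) x))) (at t)"
    using energy_density_has_derivative[OF F profile_pos[OF r] \<sigma> g]
    by (simp add: sum_distrib_left algebra_simps)
  ultimately show ?thesis by (simp add: has_field_derivative_def mult_commute_abs)
qed

end

section \<open>The energy as a Lyapunov functional\<close>

lemma dissipation_eq:
  "dissipation b F R s x = (\<Sum>i\<in>UNIV. grad (red_var_deriv F R s i) x \<bullet> red_flux b F R s i x)"
  by (simp add: dissipation_def red_flux_def inner_sum_right)

text \<open>For each of the three space directions, the dissipation contains the quadratic form of \<open>D\<close> at
  the vector of the corresponding components of the gradients.\<close>

lemma dissipation_nonneg:
  assumes "pos_def (Dmat b (completed_profile R s x))"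
  shows "0 \<le> dissipation b F R s x"
proof -
  let ?D = "Dmat b (completed_profile R s x)"
  let ?g = "\<lambda>k. \<chi> i. grad (red_var_deriv F R s i) x $ k"
  have "dissipation b F R s x = (\<Sum>i\<in>UNIV. \<Sum>j\<in>UNIV. \<Sum>k\<in>UNIV. ?g k $ i * (?D $ i $ j * ?g k $ j))"
    by (simp add: dissipation_def inner_vec_def sum_distrib_left mult_ac)
  also have "\<dots> = (\<Sum>i\<in>UNIV. \<Sum>k\<in>UNIV. \<Sum>j\<in>UNIV. ?g k $ i * (?D $ i $ j * ?g k $ j))"
    by (intro sum.cong refl sum.swap)
  also have "\<dots> = (\<Sum>k\<in>UNIV. \<Sum>i\<in>UNIV. \<Sum>j\<in>UNIV. ?g k $ i * (?D $ i $ j * ?g k $ j))"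
    by (rule sum.swap)
  also have "\<dots> = (\<Sum>k\<in>UNIV. ?g k \<bullet> (?D *v ?g k))"
    by (simp add: inner_vec_def matrix_vector_mult_def sum_distrib_left)
  finally show ?thesis using pos_def_nonneg[OF assms] by (simp add: sum_nonneg)
qed

text \<open>Since the total density does not depend on time, the time derivatives of the densities sum
  to zero, so that only the differences of the variational derivatives to the last one matter; these
  are the variational derivatives of the reduced energy.\<close>

lemma energy_dissipation:
  fixes F :: "'m::finite option \<Rightarrow> real \<Rightarrow> real^3 \<Rightarrow> real"
  assumes \<epsilon>: "0 < \<epsilon>" and I: "open I" and F: "integrand_C4 F" and N: "condition_N b"
    and pos: "positive_state I \<sigma>" and smooth: "smooth_state I \<sigma>" and decay: "decaying b F I \<sigma>"
    and total: "\<And>t. t \<in> I \<Longrightarrow> total_density (\<sigma> t) = R"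
    and sys: "reduced_system \<epsilon> b F R I (\<lambda>t. reduced_profile (\<sigma> t))"
  shows "lyapunov_identity \<epsilon> b F R I (\<lambda>t. reduced_profile (\<sigma> t))"
  unfolding lyapunov_identity_def
proof
  fix t assume t: "t \<in> I"
  note r = profile_C4_state[OF pos smooth t]
  let ?s = "reduced_profile (\<sigma> t)"
  let ?e = "\<lambda>s x. energy_density F (\<sigma> s x) (grads (\<sigma> s) x)"
  let ?w = "\<lambda>i x. deriv (\<lambda>s. \<sigma> s x $ i) t"
  let ?\<mu> = "red_var_deriv F R ?s" and ?J = "red_flux b F R ?s"
  let ?A = "\<lambda>x. \<Sum>i\<in>UNIV. ?w i x *\<^sub>R dF_dq F (\<sigma> t) i x"
  let ?B = "\<lambda>x. \<Sum>j\<in>UNIV. ?\<mu> j x *\<^sub>R ?J j x"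
  have completed: "completed_profile R (reduced_profile (\<sigma> a)) = \<sigma> a" if "a \<in> I" for a
    using completed_profile_inverse[of "\<sigma> a"] total[OF that] by simp
  have \<mu>: "Ck_on 2 UNIV (?\<mu> j)" "?\<mu> j x = var_deriv F (\<sigma> t) (Some j) x - var_deriv F (\<sigma> t) None x"
    and J: "Ck_on 1 UNIV (?J j)" for j x
    using Ck_on_red_var_deriv[OF F r] red_var_deriv_eq[OF F r] Ck_on_red_flux[OF F r N]
    by (simp_all only: total[OF t])
  have "W11 ?A \<and> W11 ?B"
    using bspec[OF decay[unfolded decaying_def] t] by (simp only: total[OF t])
  moreover have "Ck_on 1 UNIV ?A"
    by (intro Ck_on_sum Ck_on_scaleR open_UNIV Ck_on_mono[OF Ck_on_time_derivative[OF I smooth t]]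
        Ck_on_mono[OF Ck_on_dF_dq[OF F r]]) simp_all
  moreover have "Ck_on 1 UNIV ?B"
    by (intro Ck_on_sum Ck_on_scaleR open_UNIV J Ck_on_mono[OF \<mu>(1)]) simp_all
  ultimately have A: "integrable lborel (divergence ?A)" "(LINT x|lborel. divergence ?A x) = 0"
    and B: "integrable lborel (divergence ?B)" "(LINT x|lborel. divergence ?B x) = 0"
    using integral_divergence_zero by auto
  have balance: "deriv (\<lambda>a. ?e a x) t
      = \<epsilon> * (divergence ?B x - dissipation b F R ?s x) + divergence ?A x" for x
  proof -
    have wj: "?w (Some j) x = \<epsilon> * divergence (?J j) x" for j
      using sys t by (intro DERIV_imp_deriv) (simp add: reduced_system_def reduced_profile_def)
    have "((\<lambda>s. \<Sum>i\<in>UNIV. \<sigma> s x $ i) has_real_derivative (\<Sum>i\<in>UNIV. ?w i x)) (at t)"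
      by (intro DERIV_sum time_derivative(2)[OF I smooth t])
    moreover have "((\<lambda>s. \<Sum>i\<in>UNIV. \<sigma> s x $ i) has_real_derivative 0) (at t)"
    proof (rule has_field_derivative_transform_within_open[OF DERIV_const I t])
      show "R x = (\<Sum>i\<in>UNIV. \<sigma> s x $ i)" if "s \<in> I" for s
        using total[OF that] by (simp add: total_density_def fun_eq_iff)
    qed
    ultimately have w0: "(\<Sum>i\<in>UNIV. ?w i x) = 0" by (rule DERIV_unique)
    have "(\<Sum>i\<in>UNIV. ?w i x * var_deriv F (\<sigma> t) i x)
        = (\<Sum>j\<in>UNIV. ?w (Some j) x * ?\<mu> j x) + (\<Sum>i\<in>UNIV. ?w i x) * var_deriv F (\<sigma> t) None x"
      by (simp add: sum_option \<mu>(2) algebra_simps sum_subtractf sum_distrib_left)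
    also have "\<dots> = \<epsilon> * (\<Sum>j\<in>UNIV. ?\<mu> j x * divergence (?J j) x)"
      unfolding w0 by (simp add: wj sum_distrib_left mult_ac)
    also have "\<dots> = \<epsilon> * (divergence ?B x - dissipation b F R ?s x)"
    proof -
      have "?\<mu> j differentiable (at x)" "?J j differentiable (at x)" for j
        by (rule Ck_on_differentiable[OF \<mu>(1)], auto) (rule Ck_on_differentiable[OF J], auto)
      then have "divergence ?B x
          = (\<Sum>j\<in>UNIV. ?\<mu> j x * divergence (?J j) x + grad (?\<mu> j) x \<bullet> ?J j x)"
        by (subst divergence_sum) (auto simp: divergence_scaleR intro: differentiable_scaleR)
      then show ?thesis by (simp add: dissipation_eq sum.distrib)
    qed
    finally show ?thesis
      using DERIV_imp_deriv[OF energy_density_time_derivative[OF I smooth F pos t]] by simp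
  qed
  obtain \<delta> g where \<delta>: "0 < \<delta>" and g: "integrable lborel g"
    and bound: "\<And>s x. s \<in> I \<Longrightarrow> \<bar>s - t\<bar> < \<delta> \<Longrightarrow> \<bar>deriv (\<lambda>a. ?e a x) s\<bar> \<le> g x"
    using bspec[OF decay[unfolded decaying_def] t, THEN conjunct2, THEN conjunct1] by blast
  obtain \<eta> where \<eta>: "0 < \<eta>" "ball t \<eta> \<subseteq> I" using I t open_contains_ball by blast
  have near: "s \<in> I \<and> \<bar>s - t\<bar> < \<delta>" if "\<bar>s - t\<bar> < min \<delta> \<eta>" for s
    using that \<eta>(2) by (auto simp: subset_eq dist_real_def abs_minus_commute)
  have min: "0 < min \<delta> \<eta>" using \<delta> \<eta> by simp
  have int: "integrable lborel (?e s)" if "s \<in> I" for s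
    by (rule bspec[OF decay[unfolded decaying_def] that, THEN conjunct1])
  have der: "((\<lambda>a. ?e a x) has_real_derivative deriv (\<lambda>a. ?e a x) s) (at s)" if "s \<in> I" for s x
    using energy_density_time_derivative[OF I smooth F pos that, of x] by (simp add: DERIV_imp_deriv)
  \<comment> \<open>On the interval of radius \<open>min \<delta> \<eta>\<close> around \<open>t\<close> the bound \<open>g\<close> holds and all times lie in \<open>I\<close>.\<close>
  note diff = has_real_derivative_integral[where \<phi> = ?e and \<phi>' = "\<lambda>s x. deriv (\<lambda>a. ?e a x) s",
      OF min int der bound g]
  have e': "integrable lborel (\<lambda>x. deriv (\<lambda>a. ?e a x) t)"
    "((\<lambda>a. energy F (\<sigma> a)) has_real_derivative (LINT x|lborel. deriv (\<lambda>a. ?e a x) t)) (at t)"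
    using diff near by (simp_all add: energy_def[abs_def])
  \<comment> \<open>The dissipation is integrable because all other terms of the balance are.\<close>
  have diss: "dissipation b F R ?s = (\<lambda>x. divergence ?B x
      - (deriv (\<lambda>a. ?e a x) t - divergence ?A x) / \<epsilon>)"
    using \<epsilon> by (simp add: fun_eq_iff balance)
  have i: "integrable lborel (dissipation b F R ?s)"
    unfolding diss using A(1) B(1) e'(1) by simp
  have "(LINT x|lborel. deriv (\<lambda>a. ?e a x) t) = - \<epsilon> * (LINT x|lborel. dissipation b F R ?s x)"
    unfolding balance using A B i by (simp add: right_diff_distrib)
  with e'(2) have "((\<lambda>a. energy F (\<sigma> a)) has_real_derivative
      - \<epsilon> * (LINT x|lborel. dissipation b F R ?s x)) (at t)" by simp
  then have "((\<lambda>a. red_energy F R (reduced_profile (\<sigma> a))) has_real_derivative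
      - \<epsilon> * (LINT x|lborel. dissipation b F R ?s x)) (at t)"
    by (rule has_field_derivative_transform_within_open[OF _ I t]) (simp add: red_energy_def completed)
  moreover have "0 \<le> (LINT x|lborel. dissipation b F R ?s x)"
    by (intro integral_nonneg_AE AE_I2 dissipation_nonneg)
      (simp add: completed[OF t] pos_def_Dmat[OF N profile_pos[OF r]])
  ultimately show "integrable lborel (dissipation b F R ?s) \<and>
    ((\<lambda>a. red_energy F R (reduced_profile (\<sigma> a))) has_real_derivative
      - \<epsilon> * (LINT x|lborel. dissipation b F R ?s x)) (at t) \<and>
    - \<epsilon> * (LINT x|lborel. dissipation b F R ?s x) \<le> 0"
    using i \<epsilon> by simp
qed

section \<open>Reduction of the Maxwell-Stefan system\<close>

text \<open>The inverted Maxwell-Stefan relations express the first \<open>n - 1\<close> mass fluxes by \<open>D\<close> and the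
  potentials, and the last one is minus their sum; this also shows that the fluxes are
  differentiable, so that divergence and sum may be exchanged.\<close>

lemma mass_equations_reduced:
  fixes F :: "'m::finite option \<Rightarrow> real \<Rightarrow> real^3 \<Rightarrow> real"
  assumes F: "integrand_C4 F" and N: "condition_N b" and r: "profile_C4 r"
    and ms: "maxwell_stefan \<epsilon> b F r u"
  defines "J \<equiv> red_flux b F (total_density r) (reduced_profile r)"
  shows "divergence (\<lambda>y. r y $ Some i *\<^sub>R u y $ Some i) x = - \<epsilon> * divergence (J i) x"
    and "(\<Sum>i\<in>UNIV. divergence (\<lambda>y. r y $ i *\<^sub>R u y $ i) x) = 0"
proof -
  have J: "J j differentiable (at x)" for j
    unfolding J_def by (rule Ck_on_differentiable[OF Ck_on_red_flux[OF F r N]]) auto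
  have flux: "r y $ Some j *\<^sub>R u y $ Some j = - \<epsilon> *\<^sub>R J j y" for j y
    unfolding J_def by (rule maxwell_stefan_flux[OF F r N ms])
  show kept: "divergence (\<lambda>y. r y $ Some i *\<^sub>R u y $ Some i) x = - \<epsilon> * divergence (J i) x" for i
    unfolding flux by (rule divergence_cmult[OF J])
  have "(\<Sum>j\<in>UNIV. r y $ j *\<^sub>R u y $ j) = 0" for y
    using ms by (simp add: maxwell_stefan_def)
  then have "r y $ None *\<^sub>R u y $ None = - (\<Sum>j\<in>UNIV. r y $ Some j *\<^sub>R u y $ Some j)" for y
    by (simp add: sum_option eq_neg_iff_add_eq_0)
  then have last: "r y $ None *\<^sub>R u y $ None = (\<Sum>j\<in>UNIV. \<epsilon> *\<^sub>R J j y)" for y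
    unfolding flux by (simp add: sum_negf)
  have "divergence (\<lambda>y. r y $ None *\<^sub>R u y $ None) x = (\<Sum>j\<in>UNIV. \<epsilon> * divergence (J j) x)"
    unfolding last using J by (subst divergence_sum) (auto simp: divergence_cmult intro: differentiable_scaleR)
  then show "(\<Sum>i\<in>UNIV. divergence (\<lambda>y. r y $ i *\<^sub>R u y $ i) x) = 0"
    by (simp add: sum_option kept sum_negf)
qed

lemma total_density_constant:
  fixes F :: "'m::finite option \<Rightarrow> real \<Rightarrow> real^3 \<Rightarrow> real"
  assumes I: "open I" "is_interval I" and F: "integrand_C4 F" and N: "condition_N b"
    and r: "\<And>t. t \<in> I \<Longrightarrow> profile_C4 (\<rho> t)"
    and mass: "mass_equations I \<rho> v u" and v: "\<And>t x. t \<in> I \<Longrightarrow> v t x = 0"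
    and ms: "\<And>t. t \<in> I \<Longrightarrow> maxwell_stefan \<epsilon> b F (\<rho> t) (u t)"
  obtains R where "\<And>t. t \<in> I \<Longrightarrow> total_density (\<rho> t) = R"
proof -
  have "\<exists>c. \<forall>t\<in>I. total_density (\<rho> t) x = c" for x
  proof (rule has_field_derivative_zero_constant)
    show "convex I" using I(2) by (rule is_interval_convex)
    fix t assume t: "t \<in> I"
    have "((\<lambda>s. \<Sum>i\<in>UNIV. \<rho> s x $ i) has_real_derivative
        (\<Sum>i\<in>UNIV. - divergence (\<lambda>y. \<rho> t y $ i *\<^sub>R u t y $ i) x - divergence (\<lambda>y. \<rho> t y $ i *\<^sub>R v t y) x)) (at t)"
      using mass t unfolding mass_equations_def by (intro DERIV_sum) blast
    also have "(\<Sum>i\<in>UNIV. - divergence (\<lambda>y. \<rho> t y $ i *\<^sub>R u t y $ i) x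
        - divergence (\<lambda>y. \<rho> t y $ i *\<^sub>R v t y) x) = 0"
      using mass_equations_reduced(2)[OF F N r[OF t] ms[OF t], of x]
      by (simp add: v[OF t] sum_negf divergence_def[of "\<lambda>_. 0"])
    finally show "((\<lambda>t. total_density (\<rho> t) x) has_real_derivative 0) (at t within I)"
      unfolding total_density_def by (rule has_field_derivative_at_within)
  qed
  then obtain R where "\<And>t x. t \<in> I \<Longrightarrow> total_density (\<rho> t) x = R x" by metis
  then have "total_density (\<rho> t) = R" if "t \<in> I" for t
    using that by (intro ext)
  then show thesis by (rule that)
qed

theorem lemma3:
  fixes F :: "'m::finite option \<Rightarrow> real \<Rightarrow> real^3 \<Rightarrow> real"
    and b :: "real^('m option)^('m option)"
    and \<rho> :: "real \<Rightarrow> real^3 \<Rightarrow> real^('m option)"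
    and v :: "real \<Rightarrow> real^3 \<Rightarrow> real^3"
    and u :: "real \<Rightarrow> real^3 \<Rightarrow> real^3^('m option)"
    and I :: "real set"
    and \<epsilon> :: real
  assumes "0 < \<epsilon>"
    and "open I" and "is_interval I"
    and "\<And>i. Ck_on 4 ({0<..} \<times> UNIV) (\<lambda>(a, q). F i a q)"
    and "condition_N b"
    and "positive_state I \<rho>" and "smooth_state I \<rho>" and "decaying b F I \<rho>"
    and "\<And>t x. t \<in> I \<Longrightarrow> v t x = 0"
    and "mass_equations I \<rho> v u"
    and "momentum_equation I F \<rho> v"
    and "\<And>t. t \<in> I \<Longrightarrow> maxwell_stefan \<epsilon> b F (\<rho> t) (u t)"
    and "\<And>t x. t \<in> I \<Longrightarrow> pos_def (energy_hessian F (\<rho> t) x)"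
  shows "\<exists>R. (\<forall>t\<in>I. total_density (\<rho> t) = R) \<and>
    reduced_system \<epsilon> b F R I (\<lambda>t. reduced_profile (\<rho> t)) \<and>
    (\<forall>t\<in>I. \<forall>x. pos_def (Dmat b (\<rho> t x))) \<and>
    lyapunov_identity \<epsilon> b F R I (\<lambda>t. reduced_profile (\<rho> t)) \<and>
    (\<forall>s. positive_state I (\<lambda>t. completed_profile R (s t)) \<and> smooth_state I (\<lambda>t. completed_profile R (s t)) \<and>
         decaying b F I (\<lambda>t. completed_profile R (s t)) \<and> reduced_system \<epsilon> b F R I s
       \<longrightarrow> lyapunov_identity \<epsilon> b F R I s) \<and>
    (\<forall>t\<in>I. \<forall>x.
       (\<forall>\<mu>. complex_eigenvalue
              (Dmat b (\<rho> t x) ** red_energy_hessian F R (reduced_profile (\<rho> t)) x) \<mu>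
            \<longrightarrow> \<mu> \<in> \<real> \<and> 0 < Re \<mu>) \<and>
       petrovskii_parabolic (Dmat b (\<rho> t x) ** red_energy_hessian F R (reduced_profile (\<rho> t)) x))"
proof -
  note \<epsilon> = assms(1) and I = assms(2,3) and N = assms(5) and pos = assms(6) and smooth = assms(7)
    and mass = assms(10) and v = assms(9) and ms = assms(12)
  have F: "integrand_C4 F" using assms(4) by (simp add: integrand_C4_def)
  have r: "profile_C4 (\<rho> t)" if "t \<in> I" for t
    by (rule profile_C4_state[OF pos smooth that])
  obtain R where R: "\<And>t. t \<in> I \<Longrightarrow> total_density (\<rho> t) = R"
    using total_density_constant[OF I F N r mass v ms] by blast
  have sys: "reduced_system \<epsilon> b F R I (\<lambda>t. reduced_profile (\<rho> t))"
    unfolding reduced_system_def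
  proof (intro ballI allI)
    fix t x i assume t: "t \<in> I"
    have "((\<lambda>s. \<rho> s x $ Some i) has_real_derivative
        - divergence (\<lambda>y. \<rho> t y $ Some i *\<^sub>R u t y $ Some i) x - divergence (\<lambda>y. \<rho> t y $ Some i *\<^sub>R v t y) x) (at t)"
      using mass t unfolding mass_equations_def by blast
    then show "((\<lambda>a. reduced_profile (\<rho> a) x $ i) has_real_derivative
        \<epsilon> * divergence (red_flux b F R (reduced_profile (\<rho> t)) i) x) (at t)"
      using mass_equations_reduced(1)[OF F N r[OF t] ms[OF t], of i x]
      by (simp add: v[OF t] R[OF t] reduced_profile_def divergence_def[of "\<lambda>_. 0"])
  qed
  have D: "pos_def (Dmat b (\<rho> t x))" if "t \<in> I" for t x
    by (rule pos_def_Dmat[OF N profile_pos[OF r[OF that]]])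
  have lyap: "lyapunov_identity \<epsilon> b F R I s"
    if "positive_state I (\<lambda>t. completed_profile R (s t))"
      "smooth_state I (\<lambda>t. completed_profile R (s t))"
      "decaying b F I (\<lambda>t. completed_profile R (s t))" "reduced_system \<epsilon> b F R I s" for s
    using energy_dissipation[OF \<epsilon> I(1) F N that(1-3), of R] that(4)
    by (simp add: total_density_completed reduced_profile_completed)
  have ev: "\<mu> \<in> \<real> \<and> 0 < Re \<mu>"
    if t: "t \<in> I" and "complex_eigenvalue
      (Dmat b (\<rho> t x) ** red_energy_hessian F R (reduced_profile (\<rho> t)) x) \<mu>" for t x \<mu>
  proof -
    have "pos_def (red_energy_hessian F R (reduced_profile (\<rho> t)) x)"
      using pos_def_red_energy_hessian[OF F r[OF t] assms(13)[OF t]] by (simp add: R[OF t])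
    then show ?thesis using eigenvalue_pos_def_product[OF D[OF t] _ that(2)] by blast
  qed
  show ?thesis
  proof (intro exI[of _ R] conjI)
    show "lyapunov_identity \<epsilon> b F R I (\<lambda>t. reduced_profile (\<rho> t))"
      by (rule energy_dissipation[OF \<epsilon> I(1) F N pos smooth assms(8) R sys])
  qed (use R sys D lyap ev in \<open>auto simp: petrovskii_parabolic_def\<close>)
qed

end
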